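(* Let $\tau_k^{(\alpha,\beta)}$, $k,\alpha,\beta\in\mathbb Z$, be the $\tau$-functions of type $2T$ attached to the lower triangular group element $g$ (see context). For all $k\ge0$ and all $\alpha,\beta\in\mathbb Z$, $$\tau_{k}^{(\alpha+1,\beta)}\tau_{k}^{(\alpha,\beta+1)}+\tau_{k+1}^{(\alpha,\beta+1)}\tau_{k-1}^{(\alpha+1,\beta)}=\tau_{k}^{(\alpha,\beta)}\tau_{k}^{(\alpha+1,\beta+1)}.$$
   Context: Fock space. $F^{(2)}$ is the semi-infinite wedge space on $H^{(2)}=\mathbb C^2\otimes\mathbb C[z,z^{-1}]$ with basis $e_az^k$ ($a\in\{0,1\}$, $k\in\mathbb Z$). Put ${}_a\psi^+_{(k)}=e_az^k\wedge$ (wedging) and ${}_a\psi^-_{(k)}=i(e_az^{-k-1})$ (contraction); these satisfy $[{}_a\psi^+_{(k)},{}_b\psi^-_{(l)}]_+=\delta_{ab}\delta_{k+l,-1}$, all other anticommutators being zero. The vacuum $v_0=e_0\wedge e_1\wedge ze_0\wedge ze_1\wedge\cdots$ satisfies ${}_a\psi^\pm_{(k)}v_0=0$ for $k\ge0$, and $F^{(2)}$ is generated from $v_0$ by these operators. The elementary wedges $M_1M_0v_0$, where $M_a=M_a^+M_a^-$ and $M_a^\pm={}_a\psi^\pm_{(k_1)}\cdots{}_a\psi^\pm_{(k_s)}$ with $k_1<\dots<k_s\le-1$, form a basis, declared orthonormal for the bilinear form $\langle\,,\rangle$. Fermion fields: $\psi_a^\pm(z)=\sum_k{}_a\psi^\pm_{(k)}z^{-k-1}$.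 Translation operators. $Q_0,Q_1$ are the invertible operators on $F^{(2)}$ determined by $Q_a^{\pm1}v_0={}_a\psi^\pm_{(-1)}v_0$, $\psi_a^\pm(z)Q_a=z^{\pm1}Q_a\psi_a^\pm(z)$, $\psi_a^\pm(z)Q_b=-Q_b\psi_a^\pm(z)$ for $a\neq b$, and $Q_0Q_1=-Q_1Q_0$. For $k\in\mathbb Z$ put $T^{k}:=Q_0^{-k}Q_1^{k}$ (the basis element of the translation group attached to $k\alpha_1$, $\alpha_1=\delta_0-\delta_1$), and put $Q^{(\alpha,\beta)}=Q_0^\alpha Q_1^\beta$. Group element. Let $c_{k,\ell}$ ($k,\ell\in\mathbb Z$) be formal variables (they may also be specialised to complex numbers, all but finitely many zero). Let $g=\exp\big(\sum_{k,\ell\in\mathbb Z}c_{k,\ell}\,{}_1\psi^+_{(-k-1)}\,{}_0\psi^-_{(-\ell-1)}\big)$, a map $F^{(2)}\to F^{(2)}[[c_{k,\ell}]]$. $\tau$-functions of type $2T$. $\tau_k^{(\alpha,\beta)}=\langle T^kv_0,\;Q^{(\alpha,\beta)}\,g\,(Q^{(\alpha,\beta)})^{-1}v_0\rangle$. *)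

theory Defs
  imports Complex_Main "HOL-Library.Poly_Mapping" "HOL-Library.Multiset"
begin

section \<open>The semi-infinite wedge space\<close>

text \<open>
  The vectors \<open>e\<^sub>a z\<^sup>k\<close> (\<open>a \<in> {0, 1}\<close>, \<open>k \<in> \<int>\<close>) are numbered by the integers in the order in
  which they occur in the vacuum \<open>e\<^sub>0 \<and> e\<^sub>1 \<and> z e\<^sub>0 \<and> z e\<^sub>1 \<and> \<dots>\<close>: the vector \<open>e\<^sub>a z\<^sup>k\<close> has
  number \<open>2 k + a\<close>. The index \<open>a\<close> is a natural number that only takes the values 0 and 1.

  A semi-infinite wedge \<open>e(i\<^sub>0) \<and> e(i\<^sub>1) \<and> \<dots>\<close> with \<open>i\<^sub>0 < i\<^sub>1 < \<dots>\<close> that agrees with the vacuum up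
  to finitely many factors is given by its set of factors, a set of integers that differs from
  the set of nonnegative integers by finitely many elements. All charges are allowed.
\<close>

definition pos :: "nat \<Rightarrow> int \<Rightarrow> int"
  where "pos a k = 2 * k + int a"

typedef maya = "{S :: int set. finite ({0..} - S) \<and> finite (S - {0..})}"
  morphisms occ Maya
  by (rule exI[of _ "{0..}"]) simp

type_synonym fock = "maya \<Rightarrow>\<^sub>0 complex"

definition ket :: "maya \<Rightarrow> fock"
  where "ket S = Poly_Mapping.single S 1"

definition vac :: maya
  where "vac = Maya {0..}"

definition v0 :: fock
  where "v0 = ket vac"

definition fscale :: "complex \<Rightarrow> fock \<Rightarrow> fock"
  where "fscale c v = Poly_Mapping.map (\<lambda>x. c * x) v"

abbreviation flinear :: "(fock \<Rightarrow> fock) \<Rightarrow> bool"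
  where "flinear \<equiv> Vector_Spaces.linear fscale fscale"

definition linext :: "(maya \<Rightarrow> fock) \<Rightarrow> fock \<Rightarrow> fock"
  where "linext f v = (\<Sum>S\<in>Poly_Mapping.keys v. fscale (Poly_Mapping.lookup v S) (f S))"

text \<open>
  Wedging with, and contraction by, the \<open>n\<close>-th basis vector: moving it to (from) its place in the
  wedge costs one sign for each factor in front of it.
\<close>

definition wsign :: "int \<Rightarrow> maya \<Rightarrow> complex"
  where "wsign n S = (- 1) ^ card {m \<in> occ S. m < n}"

definition wedge :: "int \<Rightarrow> fock \<Rightarrow> fock"
  where "wedge n = linext (\<lambda>S. if n \<in> occ S then 0
            else fscale (wsign n S) (ket (Maya (insert n (occ S)))))"

definition contract :: "int \<Rightarrow> fock \<Rightarrow> fock"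
  where "contract n = linext (\<lambda>S. if n \<in> occ S
            then fscale (wsign n S) (ket (Maya (occ S - {n}))) else 0)"

definition psi_plus :: "nat \<Rightarrow> int \<Rightarrow> fock \<Rightarrow> fock"
  where "psi_plus a k = wedge (pos a k)"

definition psi_minus :: "nat \<Rightarrow> int \<Rightarrow> fock \<Rightarrow> fock"
  where "psi_minus a k = contract (pos a (- k - 1))"

text \<open>
  The bilinear form for which the semi-infinite wedges are orthonormal. The elementary wedges
  \<open>M\<^sub>1 M\<^sub>0 v\<^sub>0\<close> are the same vectors up to sign, hence orthonormal as well; this is
  proved in \<open>form_elem_wedge\<close> and \<open>ket_elem_wedge\<close> below.
\<close>

definition form :: "fock \<Rightarrow> fock \<Rightarrow> complex"
  where "form u v = (\<Sum>S\<in>Poly_Mapping.keys u. Poly_Mapping.lookup u S * Poly_Mapping.lookup v S)"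

definition elem_M :: "nat \<Rightarrow> int set \<Rightarrow> int set \<Rightarrow> fock \<Rightarrow> fock"
  where "elem_M a K L v = foldr (psi_plus a) (sorted_list_of_set K)
                            (foldr (psi_minus a) (sorted_list_of_set L) v)"

definition elem_wedge :: "int set \<Rightarrow> int set \<Rightarrow> int set \<Rightarrow> int set \<Rightarrow> fock"
  where "elem_wedge K1 L1 K0 L0 = elem_M 1 K1 L1 (elem_M 0 K0 L0 v0)"


section \<open>Translation operators\<close>

text \<open>
  The relations \<open>\<psi>\<^sub>a\<^sup>\<plusminus>(z) Q\<^sub>a = z\<^sup>\<plusminus>\<^sup>1 Q\<^sub>a \<psi>\<^sub>a\<^sup>\<plusminus>(z)\<close> and \<open>\<psi>\<^sub>a\<^sup>\<plusminus>(z) Q\<^sub>b = - Q\<^sub>b \<psi>\<^sub>a\<^sup>\<plusminus>(z)\<close> between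
  fields \<open>\<psi>(z) = (\<Sum>k. \<psi>\<^sub>(\<^sub>k\<^sub>) z\<^sup>-\<^sup>k\<^sup>-\<^sup>1)\<close> are written as equalities of the coefficients of
  \<open>z\<^sup>-\<^sup>k\<^sup>-\<^sup>1\<close>.
\<close>

definition shifts_field :: "nat \<Rightarrow> (fock \<Rightarrow> fock) \<Rightarrow> bool"
  where "shifts_field a Q \<longleftrightarrow> (\<forall>k v.
           psi_plus a k (Q v) = Q (psi_plus a (k + 1) v) \<and>
           psi_minus a k (Q v) = Q (psi_minus a (k - 1) v))"

definition anticommutes_field :: "nat \<Rightarrow> (fock \<Rightarrow> fock) \<Rightarrow> bool"
  where "anticommutes_field a Q \<longleftrightarrow> (\<forall>k v.
           psi_plus a k (Q v) = - Q (psi_plus a k v) \<and>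
           psi_minus a k (Q v) = - Q (psi_minus a k v))"

definition translation_ops :: "(fock \<Rightarrow> fock) \<Rightarrow> (fock \<Rightarrow> fock) \<Rightarrow> bool"
  where "translation_ops Q0 Q1 \<longleftrightarrow>
           flinear Q0 \<and> bij Q0 \<and> flinear Q1 \<and> bij Q1 \<and>
           Q0 v0 = psi_plus 0 (- 1) v0 \<and> inv Q0 v0 = psi_minus 0 (- 1) v0 \<and>
           Q1 v0 = psi_plus 1 (- 1) v0 \<and> inv Q1 v0 = psi_minus 1 (- 1) v0 \<and>
           shifts_field 0 Q0 \<and> anticommutes_field 1 Q0 \<and>
           shifts_field 1 Q1 \<and> anticommutes_field 0 Q1 \<and>
           (\<forall>v. Q0 (Q1 v) = - Q1 (Q0 v))"

text \<open>Existence and uniqueness are proved in \<open>translation_ops_ex1\<close> below.\<close>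

definition trans_pair :: "(fock \<Rightarrow> fock) \<times> (fock \<Rightarrow> fock)"
  where "trans_pair = (THE Q. translation_ops (fst Q) (snd Q))"

definition Q0 :: "fock \<Rightarrow> fock"
  where "Q0 = fst trans_pair"

definition Q1 :: "fock \<Rightarrow> fock"
  where "Q1 = snd trans_pair"

definition int_iter :: "('a \<Rightarrow> 'a) \<Rightarrow> int \<Rightarrow> 'a \<Rightarrow> 'a"
  where "int_iter f k = (if 0 \<le> k then f ^^ nat k else inv f ^^ nat (- k))"

definition Qpow :: "int \<Rightarrow> int \<Rightarrow> fock \<Rightarrow> fock"
  where "Qpow \<alpha> \<beta> = int_iter Q0 \<alpha> \<circ> int_iter Q1 \<beta>"

definition Tpow :: "int \<Rightarrow> fock \<Rightarrow> fock"
  where "Tpow k = int_iter Q0 (- k) \<circ> int_iter Q1 k"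


section \<open>Formal power series in the variables c(k, l)\<close>

text \<open>
  A monomial in the variables \<open>c(k, l)\<close>, \<open>k, l \<in> \<int>\<close>, is a finite multiset of index pairs, and a
  formal power series is an arbitrary family of coefficients indexed by the monomials. Scalar
  series form the commutative ring \<open>cseries\<close>; a series with coefficients in the Fock space is a
  plain function.
\<close>

type_synonym cmonomial = "(int \<times> int) multiset"

typedef cseries = "UNIV :: (cmonomial \<Rightarrow> complex) set"
  morphisms coefficient Series ..

setup_lifting type_definition_cseries

lemma finite_submultisets: "finite {A. A \<subseteq># (M :: 'a multiset)}"
proof (induction M)
  case (add x M)
  have "{A. A \<subseteq># add_mset x M} \<subseteq> {A. A \<subseteq># M} \<union> add_mset x ` {A. A \<subseteq># M}"
  proof
    fix A assume "A \<in> {A. A \<subseteq># add_mset x M}"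
    then have A: "A \<subseteq># add_mset x M" by simp
    show "A \<in> {A. A \<subseteq># M} \<union> add_mset x ` {A. A \<subseteq># M}"
    proof (cases "x \<in># A")
      case True
      then obtain B where "A = add_mset x B" by (meson multi_member_split)
      with A show ?thesis by auto
    next
      case False
      have "count A y \<le> count M y" for y
        using A False mset_subset_eq_count[OF A, of y] by (cases "y = x") (auto simp: not_in_iff)
      then have "A \<subseteq># M" by (simp add: subseteq_mset_def)
      then show ?thesis by simp
    qed
  qed
  with add.IH show ?case by (meson finite_UnI finite_imageI finite_subset)
qed simp

instantiation cseries :: comm_ring_1
begin

lift_definition zero_cseries :: cseries is "\<lambda>_. 0" .
lift_definition one_cseries :: cseries is "\<lambda>M. if M = {#} then 1 else 0" .
lift_definition plus_cseries :: "cseries \<Rightarrow> cseries \<Rightarrow> cseries" is "\<lambda>f g M. f M + g M" .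
lift_definition minus_cseries :: "cseries \<Rightarrow> cseries \<Rightarrow> cseries" is "\<lambda>f g M. f M - g M" .
lift_definition uminus_cseries :: "cseries \<Rightarrow> cseries" is "\<lambda>f M. - f M" .
lift_definition times_cseries :: "cseries \<Rightarrow> cseries \<Rightarrow> cseries"
  is "\<lambda>f g M. \<Sum>A | A \<subseteq># M. f A * g (M - A)" .

instance
proof
  fix a b c :: cseries
  show "a * b * c = a * (b * c)"
  proof (transfer, rule ext)
    fix f g h :: "cmonomial \<Rightarrow> complex" and M
    have "(\<Sum>A | A \<subseteq># M. (\<Sum>B | B \<subseteq># A. f B * g (A - B)) * h (M - A))
        = (\<Sum>(A, B)\<in>(SIGMA A:{A. A \<subseteq># M}. {B. B \<subseteq># A}). f B * g (A - B) * h (M - A))"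
      by (simp add: sum_distrib_right sum.Sigma finite_submultisets)
    also have "\<dots> = (\<Sum>(B, C)\<in>(SIGMA B:{B. B \<subseteq># M}. {C. C \<subseteq># M - B}).
                      f B * g C * h (M - B - C))"
      by (rule sum.reindex_bij_witness[where i = "\<lambda>(B, C). (B + C, B)" and j = "\<lambda>(A, B). (B, A - B)"])
         (auto simp: subset_mset.le_diff_conv2 subset_mset.diff_add diff_diff_add_mset add.commute
           intro: subset_mset.order_trans)
    also have "\<dots> = (\<Sum>B | B \<subseteq># M. f B * (\<Sum>C | C \<subseteq># M - B. g C * h (M - B - C)))"
      by (simp add: sum_distrib_left sum.Sigma finite_submultisets mult.assoc)
    finally show "(\<Sum>A | A \<subseteq># M. (\<Sum>B | B \<subseteq># A. f B * g (A - B)) * h (M - A))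
        = (\<Sum>B | B \<subseteq># M. f B * (\<Sum>C | C \<subseteq># M - B. g C * h (M - B - C)))" .
  qed
  show "a * b = b * a"
  proof (transfer, rule ext)
    fix f g :: "cmonomial \<Rightarrow> complex" and M :: cmonomial
    have double_diff: "M - (M - A) = A" if "A \<subseteq># M" for A :: cmonomial
      using that by (simp add: multiset_eq_iff subseteq_mset_def)
    show "(\<Sum>A | A \<subseteq># M. f A * g (M - A)) = (\<Sum>A | A \<subseteq># M. g A * f (M - A))"
      by (rule sum.reindex_bij_witness[where i = "\<lambda>A. M - A" and j = "\<lambda>A. M - A"])
         (auto simp: mult.commute double_diff)
  qed
  show "1 * a = a"
  proof (transfer, rule ext)
    fix f :: "cmonomial \<Rightarrow> complex" and M
    have "(\<Sum>A | A \<subseteq># M. (if A = {#} then 1 else 0) * f (M - A))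
        = (\<Sum>A\<in>{{#}}. (if A = {#} then 1 else 0) * f (M - A))"
      by (rule sum.mono_neutral_right) (auto simp: finite_submultisets)
    then show "(\<Sum>A | A \<subseteq># M. (if A = {#} then 1 else 0) * f (M - A)) = f M" by simp
  qed
  show "(a + b) * c = a * c + b * c"
    by transfer (simp add: distrib_right sum.distrib)
  show "(0::cseries) \<noteq> 1"
    by transfer (auto simp: fun_eq_iff)
qed (transfer; simp add: fun_eq_iff)+

end


section \<open>The group element and the tau functions\<close>

text \<open>
  The exponent \<open>\<Sum> c(k, l) \<psi>\<^sub>1\<^sup>+ \<psi>\<^sub>0\<^sup>-\<close> of \<open>g\<close> acts on series with coefficients in the
  Fock space: the coefficient of a monomial \<open>M\<close> collects, for each variable \<open>c(k, l)\<close> that occurs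
  in \<open>M\<close>, the operator of \<open>c(k, l)\<close> applied to the coefficient of \<open>M / c(k, l)\<close>.
\<close>

definition gen :: "int \<times> int \<Rightarrow> fock \<Rightarrow> fock"
  where "gen = (\<lambda>(k, l) v. psi_plus 1 (- k - 1) (psi_minus 0 (- l - 1) v))"

definition gexponent :: "(cmonomial \<Rightarrow> fock) \<Rightarrow> cmonomial \<Rightarrow> fock"
  where "gexponent u M = (\<Sum>x\<in>set_mset M. gen x (u (M - {#x#})))"

text \<open>
  The exponential series applied to the constant series \<open>v\<close>. Its terms with \<open>n > size M\<close> have
  coefficient zero at \<open>M\<close>, see \<open>gexponent_power_eq_0\<close> below.
\<close>

definition gact :: "fock \<Rightarrow> cmonomial \<Rightarrow> fock"
  where "gact v M = (\<Sum>n\<le>size M. fscale (1 / fact n)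
            ((gexponent ^^ n) (\<lambda>N. if N = {#} then v else 0) M))"

definition tau :: "int \<Rightarrow> int \<Rightarrow> int \<Rightarrow> cseries"
  where "tau k \<alpha> \<beta> =
           Series (\<lambda>M. form (Tpow k v0) (Qpow \<alpha> \<beta> (gact (inv (Qpow \<alpha> \<beta>) v0) M)))"


section \<open>Justification of the definitions\<close>

lemma lookup_fscale [simp]: "Poly_Mapping.lookup (fscale c v) S = c * Poly_Mapping.lookup v S"
  by (simp add: fscale_def map.rep_eq when_def)

lemma lookup_ket: "Poly_Mapping.lookup (ket S) T = (if S = T then 1 else 0)"
  by (simp add: ket_def lookup_single when_def)

interpretation fock: vector_space fscale
  by unfold_locales (auto intro!: poly_mapping_eqI simp: lookup_add algebra_simps)

lemma flinearI:
  assumes "\<And>u v. f (u + v) = f u + f v" and "\<And>c v. f (fscale c v) = fscale c (f v)"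
  shows "flinear f"
  by (auto simp: Vector_Spaces.linear_iff fock.vector_space_axioms assms)

lemma flinearD:
  assumes "flinear f"
  shows "f (u + v) = f u + f v" and "f (fscale c v) = fscale c (f v)"
    and "f 0 = 0" and "f (- v) = - f v"
proof -
  interpret f: Vector_Spaces.linear fscale fscale f by fact
  show "f (u + v) = f u + f v" "f (fscale c v) = fscale c (f v)" "f 0 = 0" "f (- v) = - f v"
    by (simp_all add: f.add f.scale f.zero f.neg)
qed

lemma linext_superset:
  assumes "finite A" "Poly_Mapping.keys v \<subseteq> A"
  shows "linext f v = (\<Sum>S\<in>A. fscale (Poly_Mapping.lookup v S) (f S))"
  unfolding linext_def
  by (rule sum.mono_neutral_left) (use assms in \<open>auto simp: in_keys_iff\<close>)

lemma flinear_linext: "flinear (linext f)"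
proof (rule flinearI)
  fix u v :: fock and c :: complex
  let ?A = "Poly_Mapping.keys u \<union> Poly_Mapping.keys v"
  have "linext f (u + v) = (\<Sum>S\<in>?A. fscale (Poly_Mapping.lookup (u + v) S) (f S))"
    by (rule linext_superset) (auto simp: Poly_Mapping.keys_add)
  also have "\<dots> = linext f u + linext f v"
    by (simp add: linext_superset[of ?A] lookup_add fock.scale_left_distrib sum.distrib)
  finally show "linext f (u + v) = linext f u + linext f v" .
  have "linext f (fscale c v) = (\<Sum>S\<in>Poly_Mapping.keys v. fscale (Poly_Mapping.lookup (fscale c v) S) (f S))"
    by (rule linext_superset) (auto simp: in_keys_iff)
  also have "\<dots> = fscale c (linext f v)"
    by (simp add: linext_def fock.scale_sum_right)
  finally show "linext f (fscale c v) = fscale c (linext f v)" .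
qed

lemma linext_ket [simp]: "linext f (ket S) = f S"
  by (simp add: linext_def ket_def)

lemma linext_ket_id: "linext ket v = v"
  by (rule poly_mapping_eqI)
     (simp add: linext_def lookup_sum lookup_ket in_keys_iff if_distrib cong: if_cong)

lemma flinear_sum: "flinear f \<Longrightarrow> f (sum g A) = (\<Sum>x\<in>A. f (g x))"
  by (induction A rule: infinite_finite_induct) (auto simp: flinearD)

lemma flinear_eqI:
  assumes "flinear f" "flinear g" "\<And>S. f (ket S) = g (ket S)"
  shows "f v = g v"
proof -
  have "f (linext ket v) = g (linext ket v)"
    by (simp add: linext_def flinear_sum[OF assms(1)] flinear_sum[OF assms(2)]
        flinearD[OF assms(1)] flinearD[OF assms(2)] assms(3))
  then show ?thesis by (simp add: linext_ket_id)
qed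

lemma flinear_comp: "flinear f \<Longrightarrow> flinear g \<Longrightarrow> flinear (\<lambda>v. f (g v))"
  by (rule flinearI) (simp_all add: flinearD)

lemma flinear_minus: "flinear f \<Longrightarrow> flinear (\<lambda>v. - f v)"
  by (rule flinearI) (simp_all add: flinearD)

lemma flinear_wedge: "flinear (wedge n)" and flinear_contract: "flinear (contract n)"
  by (simp_all add: wedge_def contract_def flinear_linext)

lemma ket_neq_0 [simp]: "ket S \<noteq> 0"
  by (metis lookup_ket lookup_zero zero_neq_one)

lemma occ_finite: "finite {m \<in> occ S. m < n}" "finite ({n..} - occ S)"
proof -
  have *: "finite ({0..} - occ S)" "finite (occ S - {0..})" using occ[of S] by auto
  have "{m \<in> occ S. m < n} \<subseteq> (occ S - {0..}) \<union> {0..<n}" by auto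
  with * show "finite {m \<in> occ S. m < n}" by (meson finite_UnI finite_atLeastLessThan_int finite_subset)
  have "{n..} - occ S \<subseteq> ({0..} - occ S) \<union> {n..<0}" by auto
  with * show "finite ({n..} - occ S)" by (meson finite_UnI finite_atLeastLessThan_int finite_subset)
qed

lemma occ_insert [simp]: "occ (Maya (insert n (occ S))) = insert n (occ S)"
proof (rule Maya_inverse)
  have "finite ({0..} - occ S)" "finite (occ S - {0..})" using occ[of S] by auto
  then show "insert n (occ S) \<in> {S. finite ({0..} - S) \<and> finite (S - {0..})}"
    by (auto simp: insert_Diff_if intro: finite_subset[of _ "{0..} - occ S"])
qed

lemma occ_remove [simp]: "occ (Maya (occ S - {n})) = occ S - {n}"
proof (rule Maya_inverse)
  have "finite ({0..} - occ S)" "finite (occ S - {0..})" using occ[of S] by auto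
  then show "occ S - {n} \<in> {S. finite ({0..} - S) \<and> finite (S - {0..})}"
    by (auto simp: intro: finite_subset[of _ "insert n ({0..} - occ S)"]
        finite_subset[of _ "occ S - {0..}"])
qed

lemma occ_vac [simp]: "occ vac = {0..}"
  by (simp add: vac_def Maya_inverse)

lemma occ_eqI: "occ S = occ T \<Longrightarrow> S = T"
  by (simp add: occ_inject)

lemma wedge_ket: "n \<notin> occ S \<Longrightarrow> wedge n (ket S) = fscale (wsign n S) (ket (Maya (insert n (occ S))))"
  and wedge_ket_0: "n \<in> occ S \<Longrightarrow> wedge n (ket S) = 0"
  and contract_ket: "n \<in> occ S \<Longrightarrow> contract n (ket S) = fscale (wsign n S) (ket (Maya (occ S - {n})))"
  and contract_ket_0: "n \<notin> occ S \<Longrightarrow> contract n (ket S) = 0"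
  by (simp_all add: wedge_def contract_def)

lemma wsign_square [simp]: "wsign n S * wsign n S = 1"
  by (simp add: wsign_def flip: power_add mult_2)

lemma wsign_insert [simp]: "wsign n (Maya (insert n (occ S))) = wsign n S"
  unfolding wsign_def by (rule arg_cong[where f = "\<lambda>A. (- 1) ^ card A"]) auto

lemma wsign_remove [simp]: "wsign n (Maya (occ S - {n})) = wsign n S"
  unfolding wsign_def by (rule arg_cong[where f = "\<lambda>A. (- 1) ^ card A"]) auto

lemma contract_wedge: "n \<notin> occ S \<Longrightarrow> contract n (wedge n (ket S)) = ket S"
  by (simp add: wedge_ket flinearD[OF flinear_contract] contract_ket occ_inverse)

lemma wedge_contract: "n \<in> occ S \<Longrightarrow> wedge n (contract n (ket S)) = ket S"
  by (simp add: contract_ket flinearD[OF flinear_wedge] wedge_ket occ_inverse insert_absorb)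

lemma fock_cyclic:
  assumes f: "flinear f" and g: "flinear g" and 0: "f v0 = g v0"
    and W: "\<And>n v. f v = g v \<Longrightarrow> f (wedge n v) = g (wedge n v)"
    and C: "\<And>n v. f v = g v \<Longrightarrow> f (contract n v) = g (contract n v)"
  shows "f v = g v"
proof (rule flinear_eqI[OF f g])
  fix S
  show "f (ket S) = g (ket S)"
  proof (induction "card ({0..} - occ S) + card (occ S - {0..})" arbitrary: S rule: less_induct)
    case less
    have fin: "finite ({0..} - occ S)" "finite (occ S - {0..})" using occ[of S] by auto
    consider "S = vac" | n where "n \<in> occ S" "n < 0" | n where "n \<notin> occ S" "n \<ge> 0"
      by (metis occ_eqI occ_vac atLeast_iff not_le subsetI subset_antisym)
    then show ?case
    proof cases
      case 1
      then show ?thesis using 0 by (simp add: v0_def)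
    next
      case 2
      let ?S = "Maya (occ S - {n})"
      have "{0..} - occ ?S = {0..} - occ S" "occ ?S - {0..} = (occ S - {0..}) - {n}"
        using 2 by auto
      moreover have "card ((occ S - {0..}) - {n}) < card (occ S - {0..})"
        using 2 by (intro card_Diff1_less fin) simp
      ultimately have "f (ket ?S) = g (ket ?S)" by (intro less) simp
      then have "f (contract n (ket S)) = g (contract n (ket S))"
        by (simp add: contract_ket 2 flinearD[OF f] flinearD[OF g])
      from W[OF this, of n] show ?thesis by (simp add: wedge_contract 2)
    next
      case 3
      let ?S = "Maya (insert n (occ S))"
      have "{0..} - occ ?S = ({0..} - occ S) - {n}" "occ ?S - {0..} = occ S - {0..}"
        using 3 by auto
      moreover have "card (({0..} - occ S) - {n}) < card ({0..} - occ S)"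
        using 3 by (intro card_Diff1_less fin) simp
      ultimately have "f (ket ?S) = g (ket ?S)" by (intro less) simp
      then have "f (wedge n (ket S)) = g (wedge n (ket S))"
        by (simp add: wedge_ket 3 flinearD[OF f] flinearD[OF g])
      from C[OF this, of n] show ?thesis by (simp add: contract_wedge 3)
    qed
  qed
qed

subsection \<open>Translation operators: existence and uniqueness\<close>

definition tshift :: "nat \<Rightarrow> int \<Rightarrow> int"
  where "tshift a m = (if even (m - int a) then m - 2 else m)"

lemma bij_tshift: "bij (tshift a)"
  by (rule o_bij[where g = "\<lambda>m. if even (m - int a) then m + 2 else m"])
     (auto simp: tshift_def fun_eq_iff)

lemma maya_image:
  fixes h :: "int \<Rightarrow> int"
  assumes "bij h" "\<And>m. \<bar>h m - m\<bar> \<le> 2"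
  shows "occ (Maya (h ` occ S)) = h ` occ S"
proof (rule Maya_inverse)
  have fin: "finite ({0..} - occ S)" "finite (occ S - {0..})" using occ[of S] by auto
  have "{0..} - h ` occ S \<subseteq> h ` (({0..} - occ S) \<union> {-2..-1})"
  proof
    fix x assume x: "x \<in> {0..} - h ` occ S"
    obtain y where y: "x = h y" using \<open>bij h\<close> by (metis bij_pointE)
    with x assms(2)[of y] have "y \<in> ({0..} - occ S) \<union> {-2..-1}" by auto
    with y show "x \<in> h ` (({0..} - occ S) \<union> {-2..-1})" by blast
  qed
  moreover have "h ` occ S - {0..} \<subseteq> h ` ((occ S - {0..}) \<union> {0..2})"
  proof
    fix x assume x: "x \<in> h ` occ S - {0..}"
    then obtain y where y: "x = h y" "y \<in> occ S" by auto
    with x assms(2)[of y] have "y \<in> (occ S - {0..}) \<union> {0..2}" by auto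
    with y show "x \<in> h ` ((occ S - {0..}) \<union> {0..2})" by blast
  qed
  ultimately show "h ` occ S \<in> {S. finite ({0..} - S) \<and> finite (S - {0..})}"
    using fin by (simp add: finite_subset)
qed

definition mshift :: "nat \<Rightarrow> maya \<Rightarrow> maya"
  where "mshift a S = Maya (tshift a ` occ S)"

lemma occ_mshift [simp]: "occ (mshift a S) = tshift a ` occ S"
  unfolding mshift_def by (rule maya_image[OF bij_tshift]) (auto simp: tshift_def)

lemma bij_mshift: "bij (mshift a)"
proof (rule bijI)
  show "inj (mshift a)"
    by (rule injI) (metis bij_is_inj bij_tshift inj_image_eq_iff occ_eqI occ_mshift)
  show "surj (mshift a)"
  proof (rule surjI)
    fix S
    have b: "bij (inv (tshift a))" by (rule bij_imp_bij_inv[OF bij_tshift])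
    have "\<bar>inv (tshift a) m - m\<bar> \<le> 2" for m
    proof -
      obtain k where k: "m = tshift a k" using bij_tshift by (metis bij_pointE)
      then have "inv (tshift a) m = k" by (simp add: bij_is_inj[OF bij_tshift])
      with k show ?thesis by (simp add: tshift_def)
    qed
    then have "occ (Maya (inv (tshift a) ` occ S)) = inv (tshift a) ` occ S"
      by (rule maya_image[OF b])
    then show "mshift a (Maya (inv (tshift a) ` occ S)) = S"
      by (intro occ_eqI) (simp add: image_f_inv_f bij_is_surj[OF bij_tshift])
  qed
qed

definition tcount :: "nat \<Rightarrow> maya \<Rightarrow> nat"
  where "tcount a S = card {m \<in> occ S. odd (m - int a) \<and> m + 1 \<notin> occ S}"

definition tker :: "nat \<Rightarrow> fock \<Rightarrow> fock"
  where "tker a = linext (\<lambda>S. fscale ((- 1) ^ tcount a S) (ket (mshift a S)))"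

lemma flinear_tker: "flinear (tker a)"
  by (simp add: tker_def flinear_linext)

lemma tker_ket: "tker a (ket S) = fscale ((- 1) ^ tcount a S) (ket (mshift a S))"
  by (simp add: tker_def)

lemma bij_tker: "bij (tker a)"
proof -
  define h where "h = linext (\<lambda>S. fscale ((- 1) ^ tcount a (inv (mshift a) S)) (ket (inv (mshift a) S)))"
  have lh: "flinear h" by (simp add: h_def flinear_linext)
  have li: "flinear (\<lambda>v. v)" by (rule flinearI) simp_all
  have sq: "(- 1) ^ n * (- 1) ^ n = (1 :: complex)" for n :: nat
    by (simp flip: power_add mult_2)
  have "h (tker a (ket S)) = ket S" for S
    unfolding tker_ket flinearD(2)[OF lh]
    unfolding h_def linext_ket inv_f_f[OF bij_is_inj[OF bij_mshift]]
    by (simp only: fock.scale_scale sq fock.scale_one)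
  then have "h (tker a v) = v" for v
    by (rule flinear_eqI[OF flinear_comp[OF lh flinear_tker] li])
  moreover have "tker a (h (ket S)) = ket S" for S
    unfolding h_def linext_ket flinearD(2)[OF flinear_tker] tker_ket
      surj_f_inv_f[OF bij_is_surj[OF bij_mshift]]
    by (simp only: fock.scale_scale sq fock.scale_one)
  then have "tker a (h v) = v" for v
    by (rule flinear_eqI[OF flinear_comp[OF flinear_tker lh] li])
  ultimately show ?thesis by (intro o_bij[of h]) auto
qed

lemma tcount_finite: "finite {m \<in> occ S. odd (m - int a) \<and> m + 1 \<notin> occ S}"
proof -
  have "{m \<in> occ S. odd (m - int a) \<and> m + 1 \<notin> occ S} \<subseteq> {m \<in> occ S. m < 0} \<union> (\<lambda>x. x - 1) ` ({0..} - occ S)"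
  proof
    fix m assume m: "m \<in> {m \<in> occ S. odd (m - int a) \<and> m + 1 \<notin> occ S}"
    show "m \<in> {m \<in> occ S. m < 0} \<union> (\<lambda>x. x - 1) ` ({0..} - occ S)"
    proof (cases "m < 0")
      case False
      with m have "m + 1 \<in> {0..} - occ S" "m = (m + 1) - 1" by auto
      then show ?thesis by blast
    qed (use m in simp)
  qed
  then show ?thesis using occ_finite[where S = S and n = 0] by (meson finite_UnI finite_imageI finite_subset)
qed

definition teta :: "nat \<Rightarrow> int \<Rightarrow> complex"
  where "teta a n = (if even (n - int a) then 1 else - 1)"

lemma tker_sign:
  assumes n: "n \<notin> occ S"
  shows "wsign (tshift a n) (mshift a S) * (- 1) ^ tcount a S
       = teta a n * wsign n S * (- 1) ^ tcount a (Maya (insert n (occ S)))"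
proof -
  let ?S' = "Maya (insert n (occ S))"
  have inj: "inj_on (tshift a) A" for A
    using bij_is_inj[OF bij_tshift] by (rule inj_on_subset) simp
  have c: "card {m \<in> occ (mshift a S). m < tshift a n} = card {m \<in> occ S. tshift a m < tshift a n}"
  proof -
    have "{m \<in> occ (mshift a S). m < tshift a n} = tshift a ` {m \<in> occ S. tshift a m < tshift a n}" by auto
    then show ?thesis by (simp add: card_image[OF inj])
  qed
  show ?thesis
  proof (cases "even (n - int a)")
    case True
    have 1: "{m \<in> occ S. m < n} = {m \<in> occ S. tshift a m < tshift a n} \<union> (occ S \<inter> {n - 1})"
    proof -
      have "m < n \<longleftrightarrow> tshift a m < tshift a n \<or> m = n - 1" for m
        using True unfolding tshift_def by (cases "even (m - int a)"; simp; presburger)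
      then show ?thesis by auto
    qed
    have fin: "finite {m \<in> occ S. tshift a m < tshift a n}"
      by (rule finite_subset[OF _ occ_finite(1)[where S = S and n = n]]) (use 1 in blast)
    have d1: "{m \<in> occ S. tshift a m < tshift a n} \<inter> (occ S \<inter> {n - 1}) = {}"
      using True by (auto simp: tshift_def)
    have 2: "{m \<in> occ S. odd (m - int a) \<and> m + 1 \<notin> occ S}
      = {m \<in> occ ?S'. odd (m - int a) \<and> m + 1 \<notin> occ ?S'} \<union> (occ S \<inter> {n - 1})"
      using True n by auto
    have d2: "{m \<in> occ ?S'. odd (m - int a) \<and> m + 1 \<notin> occ ?S'} \<inter> (occ S \<inter> {n - 1}) = {}" by auto
    have "card {m \<in> occ S. m < n} = card {m \<in> occ S. tshift a m < tshift a n} + card (occ S \<inter> {n - 1})"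
      unfolding 1 by (rule card_Un_disjoint[OF fin _ d1]) simp
    moreover have "tcount a S = tcount a ?S' + card (occ S \<inter> {n - 1})"
      unfolding tcount_def by (subst 2, rule card_Un_disjoint[OF tcount_finite _ d2]) simp
    ultimately show ?thesis
      unfolding wsign_def c teta_def using True
      by (simp add: power_add)
  next
    case False
    have 1: "{m \<in> occ S. tshift a m < tshift a n} = {m \<in> occ S. m < n} \<union> (occ S \<inter> {n + 1})"
    proof -
      have "tshift a m < tshift a n \<longleftrightarrow> m < n \<or> m = n + 1" for m
        using False unfolding tshift_def by (cases "even (m - int a)"; simp; presburger)
      then show ?thesis by auto
    qed
    have d1: "{m \<in> occ S. m < n} \<inter> (occ S \<inter> {n + 1}) = {}" by auto
    have 2: "{m \<in> occ ?S'. odd (m - int a) \<and> m + 1 \<notin> occ ?S'}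
      = {m \<in> occ S. odd (m - int a) \<and> m + 1 \<notin> occ S} \<union> {m. m = n \<and> n + 1 \<notin> occ S}"
      using False n by (auto simp: image_iff)
    have d2: "{m \<in> occ S. odd (m - int a) \<and> m + 1 \<notin> occ S} \<inter> {m. m = n \<and> n + 1 \<notin> occ S} = {}" using n by auto
    have "card {m \<in> occ S. tshift a m < tshift a n} = card {m \<in> occ S. m < n} + card (occ S \<inter> {n + 1})"
      unfolding 1 by (rule card_Un_disjoint[OF occ_finite(1) _ d1]) simp
    moreover have "tcount a ?S' = tcount a S + card {m. m = n \<and> n + 1 \<notin> occ S}"
      unfolding tcount_def by (subst 2, rule card_Un_disjoint[OF tcount_finite _ d2]) simp
    moreover have "card (occ S \<inter> {n + 1}) + card {m. m = n \<and> n + 1 \<notin> occ S} = 1"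
      by (cases "n + 1 \<in> occ S") auto
    ultimately show ?thesis
      unfolding wsign_def c teta_def using False
      by (simp add: minus_one_power_iff) presburger
  qed
qed

lemma mshift_insert: "Maya (insert (tshift a n) (occ (mshift a S))) = mshift a (Maya (insert n (occ S)))"
  by (rule occ_eqI, subst occ_insert) (simp only: occ_insert occ_mshift image_insert)

lemma tshift_in_iff [simp]: "tshift a n \<in> tshift a ` A \<longleftrightarrow> n \<in> A"
  using bij_is_inj[OF bij_tshift] by (simp add: inj_image_mem_iff)

lemma wedge_tker: "wedge (tshift a n) (tker a v) = fscale (teta a n) (tker a (wedge n v))"
proof (rule flinear_eqI[where f = "\<lambda>v. wedge (tshift a n) (tker a v)"
      and g = "\<lambda>v. fscale (teta a n) (tker a (wedge n v))"])
  show "flinear (\<lambda>v. wedge (tshift a n) (tker a v))"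
    by (rule flinear_comp[OF flinear_wedge flinear_tker])
  show "flinear (\<lambda>v. fscale (teta a n) (tker a (wedge n v)))"
    by (rule flinearI) (simp_all add: flinearD[OF flinear_wedge] flinearD[OF flinear_tker]
        fock.scale_right_distrib mult.commute)
  fix S
  show "wedge (tshift a n) (tker a (ket S)) = fscale (teta a n) (tker a (wedge n (ket S)))"
  proof (cases "n \<in> occ S")
    case True
    then show ?thesis
      by (simp add: tker_ket flinearD[OF flinear_wedge] wedge_ket_0 flinearD[OF flinear_tker])
  next
    case False
    then have "wedge (tshift a n) (tker a (ket S)) = fscale ((- 1) ^ tcount a S * wsign (tshift a n) (mshift a S))
        (ket (mshift a (Maya (insert n (occ S)))))"
      by (simp add: tker_ket flinearD[OF flinear_wedge] wedge_ket flip: mshift_insert)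
    also have "\<dots> = fscale (teta a n) (tker a (wedge n (ket S)))"
      using False by (simp add: wedge_ket flinearD[OF flinear_tker] tker_ket
          tker_sign[OF False] mult.commute[of "(- 1) ^ _"] mult.assoc)
    finally show ?thesis .
  qed
qed

lemma contract_tker: "contract (tshift a n) (tker a v) = fscale (teta a n) (tker a (contract n v))"
proof (rule flinear_eqI[where f = "\<lambda>v. contract (tshift a n) (tker a v)"
      and g = "\<lambda>v. fscale (teta a n) (tker a (contract n v))"])
  show "flinear (\<lambda>v. contract (tshift a n) (tker a v))"
    by (rule flinear_comp[OF flinear_contract flinear_tker])
  show "flinear (\<lambda>v. fscale (teta a n) (tker a (contract n v)))"
    by (rule flinearI) (simp_all add: flinearD[OF flinear_contract] flinearD[OF flinear_tker]
        fock.scale_right_distrib mult.commute)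
  fix S
  show "contract (tshift a n) (tker a (ket S)) = fscale (teta a n) (tker a (contract n (ket S)))"
  proof (cases "n \<in> occ S")
    case False
    then show ?thesis
      by (simp add: tker_ket flinearD[OF flinear_contract] contract_ket_0 flinearD[OF flinear_tker])
  next
    case True
    have eta: "teta a n * teta a n = 1" by (simp add: teta_def)
    let ?R = "Maya (occ S - {n})"
    have R: "tshift a n \<notin> occ (mshift a ?R)" by simp
    have "contract (tshift a n) (tker a (ket S))
        = contract (tshift a n) (tker a (wedge n (contract n (ket S))))"
      by (simp only: wedge_contract[OF True])
    also have "tker a (wedge n (contract n (ket S))) =
        fscale (teta a n) (wedge (tshift a n) (tker a (contract n (ket S))))"
      by (simp add: wedge_tker eta)
    also have "contract (tshift a n) \<dots> = fscale (teta a n) (tker a (contract n (ket S)))"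
      by (simp only: contract_ket[OF True] tker_ket flinearD[OF flinear_contract]
          flinearD[OF flinear_wedge] flinearD[OF flinear_tker] contract_wedge[OF R])
    finally show ?thesis .
  qed
qed

lemma tker_v0: "tker a v0 = psi_plus a (- 1) v0" if "a \<le> 1"
proof -
  have a: "a = 0 \<or> a = 1" using that by auto
  have "{m \<in> {0..}. odd (m - int a) \<and> m + 1 \<notin> {0..}} = {}" by auto
  then have t: "tcount a vac = 0" unfolding tcount_def occ_vac by (simp only: card.empty)
  have sub: "tshift a y = int a - 2 \<or> 0 \<le> tshift a y" if "0 \<le> y" for y
    using a that unfolding tshift_def by (elim disjE; simp; presburger)
  have sup: "\<exists>y. 0 \<le> y \<and> tshift a y = x" if "x = int a - 2 \<or> 0 \<le> x" for x
  proof (cases "even (x - int a)")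
    case True
    then have "even (x + 2 - int a)" by simp
    then have "tshift a (x + 2) = x" unfolding tshift_def by simp
    moreover have "0 \<le> x + 2" using that by auto
    ultimately show ?thesis by blast
  next
    case False
    then have "tshift a x = x" unfolding tshift_def by simp
    moreover have "0 \<le> x" using that False by auto
    ultimately show ?thesis by blast
  qed
  have im: "tshift a ` occ vac = insert (int a - 2) (occ vac)"
    unfolding occ_vac
  proof (intro equalityI subsetI)
    fix x assume "x \<in> tshift a ` {0..}"
    then show "x \<in> insert (int a - 2) {0..}" using sub by blast
  next
    fix x assume "x \<in> insert (int a - 2) {0..}"
    then show "x \<in> tshift a ` {0..}" using sup[of x] by (auto intro: image_eqI[OF sym])
  qed
  have "{m \<in> {0..}. m < int a - 2} = {}" using a by auto
  then have w: "wsign (int a - 2) vac = 1" unfolding wsign_def occ_vac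
    by (simp only: card.empty power_0)
  have n: "int a - 2 \<notin> occ vac" using a by auto
  have "pos a (- 1) = int a - 2" by (simp add: pos_def)
  then have "psi_plus a (- 1) v0 = ket (Maya (insert (int a - 2) (occ vac)))"
    unfolding psi_plus_def v0_def by (simp only: wedge_ket[OF n] w fock.scale_one)
  then show ?thesis
    unfolding v0_def tker_ket t mshift_def im by simp
qed

lemma shifts_tker: "a \<le> 1 \<Longrightarrow> shifts_field a (tker a)"
proof -
  have 1: "tshift a (pos a (k + 1)) = pos a k" "tshift a (pos a (- k)) = pos a (- k - 1)" for k
    by (simp_all add: tshift_def pos_def)
  have 2: "teta a (pos a k) = 1" for k by (simp add: teta_def pos_def)
  show ?thesis
    unfolding shifts_field_def psi_plus_def psi_minus_def
    using wedge_tker[of a "pos a (_ + 1)"] contract_tker[of a "pos a (- _)"] by (simp add: 1 2)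
qed

lemma anticommutes_tker: "(a, b) \<in> {(0, 1), (1, 0)} \<Longrightarrow> anticommutes_field b (tker a)"
proof -
  assume ab: "(a, b) \<in> {(0, 1), (1, 0)}"
  have 1: "tshift a (pos b k) = pos b k" for k using ab by (auto simp: tshift_def pos_def)
  have 2: "teta a (pos b k) = - 1" for k using ab by (auto simp: teta_def pos_def)
  show ?thesis
    unfolding anticommutes_field_def psi_plus_def psi_minus_def
    using wedge_tker[of a "pos b _"] contract_tker[of a "pos b _"] by (simp add: 1 2)
qed

lemma inv_tker_v0: "a \<le> 1 \<Longrightarrow> inv (tker a) v0 = psi_minus a (- 1) v0"
proof -
  assume a: "a \<le> 1"
  have "tker a (psi_minus a (- 1) v0) = psi_minus a 0 (tker a v0)"
    using shifts_tker[OF a] by (simp add: shifts_field_def)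
  also have "\<dots> = contract (pos a (- 1)) (wedge (pos a (- 1)) v0)"
    using a by (simp add: tker_v0 psi_minus_def psi_plus_def)
  also have "\<dots> = v0"
    using a by (simp add: v0_def contract_wedge pos_def)
  finally show ?thesis by (metis bij_inv_eq_iff bij_tker)
qed

lemma wsign_insert_above: "m < n \<Longrightarrow> wsign m (Maya (insert n (occ S))) = wsign m S"
  unfolding wsign_def occ_insert by (rule arg_cong[where f = "\<lambda>A. (- 1) ^ card A"]) auto

lemma wsign_insert_below:
  assumes "m < n" "m \<notin> occ S"
  shows "wsign n (Maya (insert m (occ S))) = - wsign n S"
proof -
  have "{x \<in> insert m (occ S). x < n} = insert m {x \<in> occ S. x < n}" using assms by auto
  then have "card {x \<in> insert m (occ S). x < n} = Suc (card {x \<in> occ S. x < n})"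
    using assms by (simp add: occ_finite)
  then show ?thesis unfolding wsign_def occ_insert by simp
qed

lemma wedge_anticomm: "wedge m (wedge n v) = - wedge n (wedge m v)"
proof -
  have *: "wedge m (wedge n v) = - wedge n (wedge m v)" if mn: "m < n" for m n
  proof (rule flinear_eqI[where f = "\<lambda>v. wedge m (wedge n v)" and g = "\<lambda>v. - wedge n (wedge m v)"])
    show "flinear (\<lambda>v. wedge m (wedge n v))" "flinear (\<lambda>v. - wedge n (wedge m v))"
      by (rule flinear_comp[OF flinear_wedge flinear_wedge]
          flinear_minus[OF flinear_comp[OF flinear_wedge flinear_wedge]])+
    fix S
    show "wedge m (wedge n (ket S)) = - wedge n (wedge m (ket S))"
    proof (cases "m \<in> occ S \<or> n \<in> occ S")
      case True
      then show ?thesis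
        by (cases "m \<in> occ S"; cases "n \<in> occ S")
           (simp_all add: wedge_ket wedge_ket_0 flinearD[OF flinear_wedge])
    next
      case False
      with mn have "m \<notin> occ (Maya (insert n (occ S)))" "n \<notin> occ (Maya (insert m (occ S)))" by auto
      then have "wedge m (wedge n (ket S)) =
            fscale (wsign n S * wsign m S) (ket (Maya (insert m (insert n (occ S)))))"
          "wedge n (wedge m (ket S)) =
            fscale (- (wsign n S * wsign m S)) (ket (Maya (insert n (insert m (occ S)))))"
        using False mn
        by (simp_all add: wedge_ket flinearD[OF flinear_wedge] wsign_insert_above wsign_insert_below mult.commute)
      then show ?thesis by (simp add: insert_commute)
    qed
  qed
  have eq: "wedge n (wedge n v) = - wedge n (wedge n v)"
  proof (rule flinear_eqI[where f = "\<lambda>v. wedge n (wedge n v)" and g = "\<lambda>v. - wedge n (wedge n v)"])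
    show "flinear (\<lambda>v. wedge n (wedge n v))" "flinear (\<lambda>v. - wedge n (wedge n v))"
      by (rule flinear_comp[OF flinear_wedge flinear_wedge]
          flinear_minus[OF flinear_comp[OF flinear_wedge flinear_wedge]])+
    show "wedge n (wedge n (ket S)) = - wedge n (wedge n (ket S))" for S
      by (cases "n \<in> occ S") (simp_all add: wedge_ket wedge_ket_0 flinearD[OF flinear_wedge])
  qed
  show ?thesis
  proof (cases m n rule: linorder_cases)
    case less
    then show ?thesis by (rule *)
  next
    case equal
    show ?thesis unfolding equal by (rule eq)
  next
    case greater
    from *[OF this] show ?thesis by (metis minus_minus)
  qed
qed

lemma tker_anticomm: "tker 0 (tker 1 v) = - tker 1 (tker 0 v)"
proof (rule fock_cyclic[where f = "\<lambda>v. tker 0 (tker 1 v)" and g = "\<lambda>v. - tker 1 (tker 0 v)"])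
  show "flinear (\<lambda>v. tker 0 (tker 1 v))" by (rule flinear_comp[OF flinear_tker flinear_tker])
  show "flinear (\<lambda>v. - tker 1 (tker 0 v))" by (rule flinear_minus[OF flinear_comp[OF flinear_tker flinear_tker]])
  have "tker 0 (tker 1 v0) = - psi_plus 1 (- 1) (psi_plus 0 (- 1) v0)"
  proof -
    have "psi_plus 1 (- 1) (tker 0 v0) = - tker 0 (psi_plus 1 (- 1) v0)"
      using anticommutes_tker[of 0 1] unfolding anticommutes_field_def by blast
    then show ?thesis by (simp add: tker_v0 del: One_nat_def)
  qed
  moreover have "tker 1 (tker 0 v0) = - psi_plus 0 (- 1) (psi_plus 1 (- 1) v0)"
  proof -
    have "psi_plus 0 (- 1) (tker 1 v0) = - tker 1 (psi_plus 0 (- 1) v0)"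
      using anticommutes_tker[of 1 0] unfolding anticommutes_field_def by blast
    then show ?thesis by (simp add: tker_v0 del: One_nat_def)
  qed
  ultimately show "tker 0 (tker 1 v0) = - tker 1 (tker 0 v0)"
    unfolding psi_plus_def using wedge_anticomm[of "pos 1 (- 1)" "pos 0 (- 1)" v0] by simp
  have s: "tshift 0 (tshift 1 n) = n - 2" "tshift 1 (tshift 0 n) = n - 2"
    and e: "teta 0 (tshift 1 n) * teta 1 n = - 1" "teta 1 (tshift 0 n) * teta 0 n = - 1" for n
    by (auto simp: tshift_def teta_def)
  fix n v assume *: "tker 0 (tker 1 v) = - tker 1 (tker 0 v)"
  have "wedge (n - 2) (tker 0 (tker 1 v)) = - tker 0 (tker 1 (wedge n v))"
    using wedge_tker[of 0 "tshift 1 n" "tker 1 v"]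
    by (simp add: s wedge_tker flinearD[OF flinear_tker] e del: One_nat_def)
  moreover have "wedge (n - 2) (tker 1 (tker 0 v)) = - tker 1 (tker 0 (wedge n v))"
    using wedge_tker[of 1 "tshift 0 n" "tker 0 v"]
    by (simp add: s wedge_tker flinearD[OF flinear_tker] e del: One_nat_def)
  moreover have "wedge (n - 2) (tker 0 (tker 1 v)) = - wedge (n - 2) (tker 1 (tker 0 v))"
    unfolding * by (rule flinearD(4)[OF flinear_wedge])
  ultimately show "tker 0 (tker 1 (wedge n v)) = - tker 1 (tker 0 (wedge n v))"
    by (metis minus_minus)
  have "contract (n - 2) (tker 0 (tker 1 v)) = - tker 0 (tker 1 (contract n v))"
    using contract_tker[of 0 "tshift 1 n" "tker 1 v"]
    by (simp add: s contract_tker flinearD[OF flinear_tker] e del: One_nat_def)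
  moreover have "contract (n - 2) (tker 1 (tker 0 v)) = - tker 1 (tker 0 (contract n v))"
    using contract_tker[of 1 "tshift 0 n" "tker 0 v"]
    by (simp add: s contract_tker flinearD[OF flinear_tker] e del: One_nat_def)
  moreover have "contract (n - 2) (tker 0 (tker 1 v)) = - contract (n - 2) (tker 1 (tker 0 v))"
    unfolding * by (rule flinearD(4)[OF flinear_contract])
  ultimately show "tker 0 (tker 1 (contract n v)) = - tker 1 (tker 0 (contract n v))"
    by (metis minus_minus)
qed

lemma translation_ops_exists: "translation_ops (tker 0) (tker 1)"
  by (simp add: translation_ops_def flinear_tker bij_tker tker_v0 inv_tker_v0 shifts_tker
      anticommutes_tker tker_anticomm del: One_nat_def)

lemma pos_cases: "\<exists>k. n = pos 0 k \<or> n = pos 1 k"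
  by (rule exI[of _ "n div 2"]) (simp add: pos_def; presburger)

lemma translation_unique:
  assumes f: "flinear f" "f v0 = psi_plus a (- 1) v0" "shifts_field a f" "anticommutes_field b f"
    and g: "flinear g" "g v0 = psi_plus a (- 1) v0" "shifts_field a g" "anticommutes_field b g"
    and ab: "(a, b) \<in> {(0, 1), (1, 0)}"
  shows "f = g"
proof
  fix v
  have posE: "(\<exists>k. n = pos a k) \<or> (\<exists>k. n = pos b k)" for n
    using pos_cases[of n] ab by auto
  show "f v = g v"
  proof (rule fock_cyclic[OF f(1) g(1)])
    show "f v0 = g v0" by (simp add: f g)
    fix n v assume *: "f v = g v"
    have A: "h (wedge (pos a k) v) = wedge (pos a (k - 1)) (h v)"
       "h (contract (pos a k) v) = contract (pos a (k - 1)) (h v)" if "shifts_field a h" for h k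
      using that[unfolded shifts_field_def psi_plus_def psi_minus_def, rule_format, of "k - 1" v]
        that[unfolded shifts_field_def psi_plus_def psi_minus_def, rule_format, of "- k" v] by simp_all
    have B: "h (wedge (pos b k) v) = - wedge (pos b k) (h v)"
       "h (contract (pos b k) v) = - contract (pos b k) (h v)" if "anticommutes_field b h" for h k
      using that[unfolded anticommutes_field_def psi_plus_def psi_minus_def, rule_format, of k v]
        that[unfolded anticommutes_field_def psi_plus_def psi_minus_def, rule_format, of "- k - 1" v] by simp_all
    show "f (wedge n v) = g (wedge n v)" "f (contract n v) = g (contract n v)"
      using posE[of n] A[OF f(3)] A[OF g(3)] B[OF f(4)] B[OF g(4)] * by auto
  qed
qed

theorem translation_ops_ex1: "\<exists>!Q. translation_ops (fst Q) (snd Q)"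
proof (rule ex1I[of _ "(tker 0, tker 1)"])
  show "translation_ops (fst (tker 0, tker 1)) (snd (tker 0, tker 1))"
    unfolding fst_conv snd_conv by (rule translation_ops_exists)
  fix Q assume "translation_ops (fst Q) (snd Q)"
  then have "fst Q = tker 0" "snd Q = tker 1"
    using translation_ops_exists unfolding translation_ops_def
    by (auto intro!: translation_unique[of "fst Q" 0 1] translation_unique[of "snd Q" 1 0])
  then show "Q = (tker 0, tker 1)" by (simp add: prod_eq_iff)
qed

lemma translation_ops_Q: "translation_ops Q0 Q1"
  using theI'[OF translation_ops_ex1] by (simp add: Q0_def Q1_def trans_pair_def)

subsection \<open>Elementary wedges\<close>

definition signed_ket :: "fock \<Rightarrow> int set \<Rightarrow> bool"
  where "signed_ket v A \<longleftrightarrow> (\<exists>s S. (s = 1 \<or> s = - 1) \<and> v = fscale s (ket S) \<and> occ S = A)"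

lemma wsign_cases: "wsign n S = 1 \<or> wsign n S = - 1"
  by (simp add: wsign_def minus_one_power_iff)

lemma signed_ket_wedge:
  assumes "signed_ket v A" "n \<notin> A"
  shows "signed_ket (wedge n v) (insert n A)"
proof -
  obtain s S where S: "s = 1 \<or> s = - 1" "v = fscale s (ket S)" "occ S = A"
    using assms(1) unfolding signed_ket_def by blast
  have "wedge n v = fscale (s * wsign n S) (ket (Maya (insert n (occ S))))"
    using S assms(2) by (simp add: flinearD[OF flinear_wedge] wedge_ket)
  moreover have "s * wsign n S = 1 \<or> s * wsign n S = - 1" using S(1) wsign_cases[of n S] by auto
  ultimately show ?thesis unfolding signed_ket_def using S(3) occ_insert[of n S] by blast
qed

lemma signed_ket_contract:
  assumes "signed_ket v A" "n \<in> A"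
  shows "signed_ket (contract n v) (A - {n})"
proof -
  obtain s S where S: "s = 1 \<or> s = - 1" "v = fscale s (ket S)" "occ S = A"
    using assms(1) unfolding signed_ket_def by blast
  have "contract n v = fscale (s * wsign n S) (ket (Maya (occ S - {n})))"
    using S assms(2) by (simp add: flinearD[OF flinear_contract] contract_ket)
  moreover have "s * wsign n S = 1 \<or> s * wsign n S = - 1" using S(1) wsign_cases[of n S] by auto
  ultimately show ?thesis unfolding signed_ket_def using S(3) occ_remove[of S n] by blast
qed

lemma signed_ket_foldr_plus:
  "\<lbrakk>signed_ket v A; distinct ks; pos a ` set ks \<inter> A = {}\<rbrakk>
    \<Longrightarrow> signed_ket (foldr (psi_plus a) ks v) (A \<union> pos a ` set ks)"
proof (induction ks)
  case (Cons k ks)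
  then have "signed_ket (foldr (psi_plus a) ks v) (A \<union> pos a ` set ks)" by simp
  moreover have "pos a k \<notin> A \<union> pos a ` set ks" using Cons.prems by (auto simp: pos_def)
  ultimately show ?case
    using signed_ket_wedge[of _ "A \<union> pos a ` set ks" "pos a k"] by (simp add: psi_plus_def[of a k])
qed simp

lemma signed_ket_foldr_minus:
  "\<lbrakk>signed_ket v A; distinct ks; (\<lambda>k. pos a (- k - 1)) ` set ks \<subseteq> A\<rbrakk>
    \<Longrightarrow> signed_ket (foldr (psi_minus a) ks v) (A - (\<lambda>k. pos a (- k - 1)) ` set ks)"
proof (induction ks)
  case (Cons k ks)
  let ?B = "(\<lambda>k. pos a (- k - 1)) ` set ks"
  have "signed_ket (foldr (psi_minus a) ks v) (A - ?B)" using Cons by simp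
  moreover have "pos a (- k - 1) \<in> A - ?B" using Cons.prems by (auto simp: pos_def)
  ultimately have "signed_ket (foldr (psi_minus a) (k # ks) v) (A - ?B - {pos a (- k - 1)})"
    using signed_ket_contract[of _ "A - ?B" "pos a (- k - 1)"] by (simp add: psi_minus_def[of a k])
  moreover have "A - ?B - {pos a (- k - 1)} = A - (\<lambda>k. pos a (- k - 1)) ` set (k # ks)" by auto
  ultimately show ?case by simp
qed simp

definition elem_occ :: "int set \<Rightarrow> int set \<Rightarrow> int set \<Rightarrow> int set \<Rightarrow> int set"
  where "elem_occ K1 L1 K0 L0 =
     ({0..} - (\<lambda>k. pos 0 (- k - 1)) ` L0 \<union> pos 0 ` K0) - (\<lambda>k. pos 1 (- k - 1)) ` L1 \<union> pos 1 ` K1"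

definition neg_sets :: "int set \<Rightarrow> int set \<Rightarrow> int set \<Rightarrow> int set \<Rightarrow> bool"
  where "neg_sets K1 L1 K0 L0 \<longleftrightarrow> (\<forall>K\<in>{K1, L1, K0, L0}. finite K \<and> K \<subseteq> {..- 1})"

lemma signed_ket_elem_wedge:
  assumes "neg_sets K1 L1 K0 L0"
  shows "signed_ket (elem_wedge K1 L1 K0 L0) (elem_occ K1 L1 K0 L0)"
proof -
  have f: "finite K1" "finite L1" "finite K0" "finite L0"
    and n: "K1 \<subseteq> {..- 1}" "L1 \<subseteq> {..- 1}" "K0 \<subseteq> {..- 1}" "L0 \<subseteq> {..- 1}"
    using assms by (auto simp: neg_sets_def)
  have p: "pos 0 k \<noteq> pos 1 l" "pos 1 k \<noteq> pos 0 l" for k l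
    unfolding pos_def by presburger+
  have q: "pos a k < 0" if "k \<le> - 1" "a = 0 \<or> a = 1" for a k
    using that by (auto simp: pos_def)
  have q': "pos a (- k - 1) \<ge> 0" if "k \<le> - 1" for a k using that by (simp add: pos_def)
  have "signed_ket v0 {0..}"
    unfolding signed_ket_def v0_def by (rule exI[of _ 1], rule exI[of _ vac]) simp
  moreover have "(\<lambda>k. pos 0 (- k - 1)) ` L0 \<subseteq> {0..}" using n q' by (auto simp: subset_iff)
  ultimately have "signed_ket (foldr (psi_minus 0) (sorted_list_of_set L0) v0)
      ({0..} - (\<lambda>k. pos 0 (- k - 1)) ` L0)"
    using signed_ket_foldr_minus[of v0 "{0..}" "sorted_list_of_set L0" 0]
    by (simp add: f)
  moreover have "pos 0 ` K0 \<inter> ({0..} - (\<lambda>k. pos 0 (- k - 1)) ` L0) = {}"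
  proof -
    have "x < 0" if "x \<in> pos 0 ` K0" for x using that n(3) q[of _ 0] by auto
    then show ?thesis by fastforce
  qed
  ultimately have "signed_ket (elem_M 0 K0 L0 v0) ({0..} - (\<lambda>k. pos 0 (- k - 1)) ` L0 \<union> pos 0 ` K0)"
    using signed_ket_foldr_plus[of _ "{0..} - (\<lambda>k. pos 0 (- k - 1)) ` L0" "sorted_list_of_set K0" 0]
    unfolding elem_M_def by (simp add: f)
  moreover have "(\<lambda>k. pos 1 (- k - 1)) ` L1 \<subseteq> {0..} - (\<lambda>k. pos 0 (- k - 1)) ` L0 \<union> pos 0 ` K0"
  proof
    fix x assume "x \<in> (\<lambda>k. pos 1 (- k - 1)) ` L1"
    then obtain k where "x = pos 1 (- k - 1)" "k \<le> - 1" using n(2) by auto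
    then show "x \<in> {0..} - (\<lambda>k. pos 0 (- k - 1)) ` L0 \<union> pos 0 ` K0"
      using q'[of k 1] p(2) by (auto simp del: One_nat_def)
  qed
  ultimately have "signed_ket (foldr (psi_minus 1) (sorted_list_of_set L1) (elem_M 0 K0 L0 v0))
     (({0..} - (\<lambda>k. pos 0 (- k - 1)) ` L0 \<union> pos 0 ` K0) - (\<lambda>k. pos 1 (- k - 1)) ` L1)"
    using signed_ket_foldr_minus[of _ "{0..} - (\<lambda>k. pos 0 (- k - 1)) ` L0 \<union> pos 0 ` K0"
        "sorted_list_of_set L1" 1] by (simp add: f del: One_nat_def)
  moreover have "pos 1 ` K1 \<inter> (({0..} - (\<lambda>k. pos 0 (- k - 1)) ` L0 \<union> pos 0 ` K0)
      - (\<lambda>k. pos 1 (- k - 1)) ` L1) = {}"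
  proof -
    have "x < 0 \<and> x \<notin> pos 0 ` K0" if "x \<in> pos 1 ` K1" for x
      using that n(1) q[of _ 1] p by auto
    then show ?thesis by fastforce
  qed
  ultimately show ?thesis
    using signed_ket_foldr_plus[of _ "({0..} - (\<lambda>k. pos 0 (- k - 1)) ` L0 \<union> pos 0 ` K0)
        - (\<lambda>k. pos 1 (- k - 1)) ` L1" "sorted_list_of_set K1" 1]
    unfolding elem_M_def elem_wedge_def elem_occ_def by (simp add: f del: One_nat_def)
qed

lemma elem_occ_iff:
  assumes "neg_sets K1 L1 K0 L0"
  shows "pos 1 k \<in> elem_occ K1 L1 K0 L0 \<longleftrightarrow> (if k \<le> - 1 then k \<in> K1 else - k - 1 \<notin> L1)"
    and "pos 0 k \<in> elem_occ K1 L1 K0 L0 \<longleftrightarrow> (if k \<le> - 1 then k \<in> K0 else - k - 1 \<notin> L0)"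
proof -
  have p: "pos 0 k \<noteq> pos 1 l" "pos 1 k \<noteq> pos 0 l" for k l
    unfolding pos_def by presburger+
  have i: "pos a k = pos a l \<longleftrightarrow> k = l" for a k l by (simp add: pos_def)
  have z: "pos 1 k \<ge> 0 \<longleftrightarrow> \<not> k \<le> - 1" "pos 0 k \<ge> 0 \<longleftrightarrow> \<not> k \<le> - 1" by (auto simp: pos_def)
  have e: "k = - l - 1 \<longleftrightarrow> l = - k - 1" for l by auto
  have n: "x \<le> - 1" if "x \<in> K1 \<or> x \<in> L1 \<or> x \<in> K0 \<or> x \<in> L0" for x
    using assms that by (auto simp: neg_sets_def)
  show "pos 1 k \<in> elem_occ K1 L1 K0 L0 \<longleftrightarrow> (if k \<le> - 1 then k \<in> K1 else - k - 1 \<notin> L1)"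
    using n[of k] by (auto simp: elem_occ_def image_iff p i z e simp del: One_nat_def)
  show "pos 0 k \<in> elem_occ K1 L1 K0 L0 \<longleftrightarrow> (if k \<le> - 1 then k \<in> K0 else - k - 1 \<notin> L0)"
    using n[of k] by (auto simp: elem_occ_def image_iff p i z e simp del: One_nat_def)
qed

lemma neg_set_eqI:
  assumes "K \<subseteq> {..- 1}" "K' \<subseteq> {..- 1}" "\<And>k :: int. k \<le> - 1 \<Longrightarrow> k \<in> K \<longleftrightarrow> k \<in> K'"
  shows "K = K'"
  using assms by (auto simp: subset_iff)

lemma elem_occ_inj:
  assumes N: "neg_sets K1 L1 K0 L0" and N': "neg_sets K1' L1' K0' L0'"
    and eq: "elem_occ K1 L1 K0 L0 = elem_occ K1' L1' K0' L0'"
  shows "K1 = K1'" "L1 = L1'" "K0 = K0'" "L0 = L0'"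
proof -
  note iff = elem_occ_iff[OF N] elem_occ_iff[OF N', folded eq]
  have s: "K1 \<subseteq> {..- 1}" "L1 \<subseteq> {..- 1}" "K0 \<subseteq> {..- 1}" "L0 \<subseteq> {..- 1}"
    "K1' \<subseteq> {..- 1}" "L1' \<subseteq> {..- 1}" "K0' \<subseteq> {..- 1}" "L0' \<subseteq> {..- 1}"
    using N N' by (auto simp: neg_sets_def)
  have "k \<in> K1 \<longleftrightarrow> k \<in> K1'" "k \<in> K0 \<longleftrightarrow> k \<in> K0'" if "k \<le> - 1" for k
    using iff(1)[of k] iff(3)[of k] iff(2)[of k] iff(4)[of k] that by auto
  then show "K1 = K1'" "K0 = K0'" using s by (auto intro!: neg_set_eqI)
  have "k \<in> L1 \<longleftrightarrow> k \<in> L1'" "k \<in> L0 \<longleftrightarrow> k \<in> L0'" if "k \<le> - 1" for k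
    using iff(1)[of "- k - 1"] iff(3)[of "- k - 1"] iff(2)[of "- k - 1"] iff(4)[of "- k - 1"] that by auto
  then show "L1 = L1'" "L0 = L0'" using s by (auto intro!: neg_set_eqI)
qed

lemma form_ket: "form (fscale c (ket S)) (fscale d (ket T)) = (if S = T then c * d else 0)"
proof -
  have "form (fscale c (ket S)) (fscale d (ket T))
      = (\<Sum>U\<in>{S}. Poly_Mapping.lookup (fscale c (ket S)) U * Poly_Mapping.lookup (fscale d (ket T)) U)"
    unfolding form_def
    by (rule sum.mono_neutral_left) (auto simp: in_keys_iff lookup_ket split: if_splits)
  then show ?thesis by (simp add: lookup_ket)
qed

theorem form_elem_wedge:
  assumes "neg_sets K1 L1 K0 L0" "neg_sets K1' L1' K0' L0'"
  shows "form (elem_wedge K1 L1 K0 L0) (elem_wedge K1' L1' K0' L0')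
           = (if K1 = K1' \<and> L1 = L1' \<and> K0 = K0' \<and> L0 = L0' then 1 else 0)"
proof -
  obtain s S where S: "s = 1 \<or> s = - 1" "elem_wedge K1 L1 K0 L0 = fscale s (ket S)"
      "occ S = elem_occ K1 L1 K0 L0"
    using signed_ket_elem_wedge[OF assms(1)] unfolding signed_ket_def by blast
  obtain t T where T: "t = 1 \<or> t = - 1" "elem_wedge K1' L1' K0' L0' = fscale t (ket T)"
      "occ T = elem_occ K1' L1' K0' L0'"
    using signed_ket_elem_wedge[OF assms(2)] unfolding signed_ket_def by blast
  show ?thesis
  proof (cases "K1 = K1' \<and> L1 = L1' \<and> K0 = K0' \<and> L0 = L0'")
    case True
    then have "fscale t (ket T) = fscale s (ket S)" using S(2) T(2) by simp
    then show ?thesis using True S(1) by (auto simp: S(2) T(2) form_ket)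
  next
    case False
    then have "S \<noteq> T" using elem_occ_inj[OF assms] S(3) T(3) by auto
    then show ?thesis using False by (simp add: S(2) T(2) form_ket)
  qed
qed

theorem ket_elem_wedge:
  "\<exists>s K1 L1 K0 L0. (s = 1 \<or> s = - 1) \<and> neg_sets K1 L1 K0 L0 \<and>
     ket S = fscale s (elem_wedge K1 L1 K0 L0)"
proof -
  define K where "K a = {k. k \<le> - 1 \<and> pos a k \<in> occ S}" for a
  define L where "L a = {k. k \<le> - 1 \<and> pos a (- k - 1) \<notin> occ S}" for a
  have fin: "finite ({0..} - occ S)" "finite (occ S - {0..})" using occ[of S] by auto
  have K: "finite (K a)" if "a = 0 \<or> a = 1" for a
  proof (rule finite_imageD)
    show "inj_on (pos a) (K a)" by (auto simp: inj_on_def pos_def)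
    have "pos a ` K a \<subseteq> occ S - {0..}" using that by (auto simp: K_def pos_def)
    then show "finite (pos a ` K a)" by (rule finite_subset) (rule fin)
  qed
  have L: "finite (L a)" for a
  proof (rule finite_imageD)
    show "inj_on (\<lambda>k. pos a (- k - 1)) (L a)" by (auto simp: inj_on_def pos_def)
    have "(\<lambda>k. pos a (- k - 1)) ` L a \<subseteq> {0..} - occ S" by (auto simp: L_def pos_def)
    then show "finite ((\<lambda>k. pos a (- k - 1)) ` L a)" by (rule finite_subset) (rule fin)
  qed
  have N: "neg_sets (K 1) (L 1) (K 0) (L 0)"
    using K L by (auto simp: neg_sets_def K_def L_def)
  have "elem_occ (K 1) (L 1) (K 0) (L 0) = occ S"
  proof (rule set_eqI)
    fix n
    obtain k where k: "n = pos 0 k \<or> n = pos 1 k" using pos_cases by blast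
    have "pos 1 k \<in> elem_occ (K 1) (L 1) (K 0) (L 0) \<longleftrightarrow> pos 1 k \<in> occ S"
        "pos 0 k \<in> elem_occ (K 1) (L 1) (K 0) (L 0) \<longleftrightarrow> pos 0 k \<in> occ S"
      unfolding elem_occ_iff[OF N] by (auto simp: K_def L_def simp del: One_nat_def)
    with k show "n \<in> elem_occ (K 1) (L 1) (K 0) (L 0) \<longleftrightarrow> n \<in> occ S" by blast
  qed
  with signed_ket_elem_wedge[OF N] obtain s where s: "s = 1 \<or> s = - 1"
      "elem_wedge (K 1) (L 1) (K 0) (L 0) = fscale s (ket S)"
    unfolding signed_ket_def by (metis occ_eqI)
  then have "ket S = fscale s (elem_wedge (K 1) (L 1) (K 0) (L 0))" by auto
  with s(1) N show ?thesis by blast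
qed

subsection \<open>The exponential series\<close>

lemma gen_0 [simp]: "gen x 0 = 0"
  by (simp add: gen_def psi_plus_def psi_minus_def flinearD[OF flinear_wedge]
      flinearD[OF flinear_contract] split: prod.split)

lemma gexponent_power_eq_0:
  "size M < n \<Longrightarrow> (gexponent ^^ n) u M = 0"
proof (induction n arbitrary: M)
  case (Suc n)
  have "gen x ((gexponent ^^ n) u (M - {#x#})) = 0" if "x \<in># M" for x
  proof -
    have "size (M - {#x#}) < size M" using that by (rule size_Diff1_less)
    with Suc have "(gexponent ^^ n) u (M - {#x#}) = 0" by auto
    then show ?thesis by simp
  qed
  then show ?case
    unfolding funpow.simps comp_def gexponent_def[of "(gexponent ^^ n) u" M] by simp
qed simp

end

theory Submission
  imports Defs "Jordan_Normal_Form.Char_Poly"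
begin

text \<open>
  Conjugation by \<open>Q\<^sub>0\<^sup>\<alpha> Q\<^sub>1\<^sup>\<beta>\<close> multiplies the exponent of \<open>g\<close> by \<open>(-1)\<^sup>\<alpha>\<^sup>+\<^sup>\<beta>\<close> and shifts its
  indices. Its terms commute and anticommute under exchanging their contractions, so pairing with
  \<open>T\<^sup>k v\<^sub>0\<close> leaves a \<open>k \<times> k\<close> determinant: up to a sign, \<open>\<tau>\<^sub>k\<close> is \<open>det (c(i - \<beta>, j + \<alpha>))\<close> with
  \<open>0 \<le> i, j < k\<close>. The six determinants in the theorem are a \<open>(k + 1) \<times> (k + 1)\<close> determinant, its
  four corner minors and its central minor, and the theorem is the Desnanot--Jacobi identity. For
  \<open>k = 0\<close> it only says \<open>1 = 1\<close>, because \<open>\<tau>\<^sub>-\<^sub>1 = 0\<close> for reasons of charge.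
\<close>

unbundle no m_inv_syntax

section \<open>The Desnanot--Jacobi identity\<close>

lemma det_reduce_row:
  fixes A :: "'a :: comm_ring_1 mat"
  assumes A: "A \<in> carrier_mat n n" and "i < n" "j < n"
    and z: "\<And>l. l < n \<Longrightarrow> l \<noteq> j \<Longrightarrow> A $$ (i, l) = 0"
  shows "det A = A $$ (i, j) * cofactor A i j"
proof -
  have "det A = (\<Sum>l<n. A $$ (i, l) * cofactor A i l)"
    by (rule laplace_expansion_row[OF A \<open>i < n\<close>])
  also have "\<dots> = (\<Sum>l\<in>{j}. A $$ (i, l) * cofactor A i l)"
    by (rule sum.mono_neutral_right) (use assms in auto)
  finally show ?thesis by simp
qed

lemma det_reduce_column:
  fixes A :: "'a :: comm_ring_1 mat"
  assumes A: "A \<in> carrier_mat n n" and "i < n" "j < n"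
    and z: "\<And>l. l < n \<Longrightarrow> l \<noteq> i \<Longrightarrow> A $$ (l, j) = 0"
  shows "det A = A $$ (i, j) * cofactor A i j"
proof -
  have "det A = (\<Sum>l<n. A $$ (l, j) * cofactor A l j)"
    by (rule laplace_expansion_column[OF A \<open>j < n\<close>])
  also have "\<dots> = (\<Sum>l\<in>{i}. A $$ (l, j) * cofactor A l j)"
    by (rule sum.mono_neutral_right) (use assms in auto)
  finally show ?thesis by simp
qed

text \<open>Row 0 vanishes outside its two end entries, and deleting it with an end column leaves a
  matrix that reduces along its last row to an identity matrix.\<close>

lemma det_identity_with_end_columns:
  fixes u v :: "nat \<Rightarrow> 'a :: comm_ring_1"
  shows "det (mat (m + 2) (m + 2) (\<lambda>(i, j). if j = 0 then u i else if j = m + 1 then v i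
           else if i = j then 1 else 0)) = u 0 * v (m + 1) - v 0 * u (m + 1)"
    (is "det ?N = _")
proof -
  have N: "?N \<in> carrier_mat (m + 2) (m + 2)" by simp
  let ?U = "mat (m + 1) (m + 1) (\<lambda>(i, j). if j = m then v (i + 1) else if i = j then 1 else 0)"
  let ?V = "mat (m + 1) (m + 1) (\<lambda>(i, j). if j = 0 then u (i + 1) else if i + 1 = j then 1 else 0)"
  have d0: "mat_delete ?N 0 0 = ?U" and d1: "mat_delete ?N 0 (m + 1) = ?V"
    by (rule eq_matI; simp add: mat_delete_def)+
  have "mat_delete ?U m m = 1\<^sub>m m" "mat_delete ?V m 0 = 1\<^sub>m m"
    by (rule eq_matI; simp add: mat_delete_def)+
  then have c: "cofactor ?U m m = 1" "cofactor ?V m 0 = (- 1) ^ m"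
    by (simp_all add: cofactor_def flip: mult_2)
  have "det ?U = ?U $$ (m, m) * cofactor ?U m m"
    by (rule det_reduce_row[where n = "m + 1"]) auto
  then have U: "det ?U = v (m + 1)" unfolding c by simp
  have "det ?V = ?V $$ (m, 0) * cofactor ?V m 0"
    by (rule det_reduce_row[where n = "m + 1"]) auto
  then have V: "det ?V = u (m + 1) * (- 1) ^ m" unfolding c by simp
  have "det ?N = (\<Sum>j<m + 2. ?N $$ (0, j) * cofactor ?N 0 j)"
    by (rule laplace_expansion_row[OF N]) simp
  also have "\<dots> = (\<Sum>j\<in>{0, m + 1}. ?N $$ (0, j) * cofactor ?N 0 j)"
    by (rule sum.mono_neutral_right) auto
  also have "\<dots> = u 0 * cofactor ?N 0 0 + v 0 * cofactor ?N 0 (m + 1)" by simp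
  also have "cofactor ?N 0 0 = v (m + 1)" using d0 U by (simp add: cofactor_def)
  also have "cofactor ?N 0 (m + 1) = - u (m + 1)"
    using d1 V by (simp add: cofactor_def mult.left_commute flip: power_add mult_2)
  finally show ?thesis by simp
qed

text \<open>In an array of size m + 2, size m + 1 with offsets 0 or 1 gives the four corner minors,
  and size m with both offsets 1 the central minor.\<close>

definition consecutive_minor :: "(nat \<Rightarrow> nat \<Rightarrow> 'a) \<Rightarrow> nat \<Rightarrow> nat \<Rightarrow> nat \<Rightarrow> 'a :: comm_ring_1"
  where "consecutive_minor f n r c = det (mat n n (\<lambda>(i, j). f (i + r) (j + c)))"

text \<open>
  Multiply the matrix by the identity matrix whose two end columns are replaced by those of the
  adjugate: the product is block triangular, with the determinant in two corners.
\<close>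

lemma desnanot_jacobi_times_det:
  fixes f :: "nat \<Rightarrow> nat \<Rightarrow> 'a :: comm_ring_1"
  shows "consecutive_minor f (m + 2) 0 0
           * (consecutive_minor f (m + 1) 1 1 * consecutive_minor f (m + 1) 0 0
              - consecutive_minor f (m + 1) 1 0 * consecutive_minor f (m + 1) 0 1)
       = consecutive_minor f (m + 2) 0 0
           * (consecutive_minor f (m + 2) 0 0 * consecutive_minor f m 1 1)"
proof -
  define A where "A = mat (m + 2) (m + 2) (\<lambda>(i, j). f i j)"
  have A: "A \<in> carrier_mat (m + 2) (m + 2)" by (simp add: A_def)
  define u where "u i = adj_mat A $$ (i, 0)" for i
  define v where "v i = adj_mat A $$ (i, m + 1)" for i
  let ?N = "mat (m + 2) (m + 2) (\<lambda>(i, j). if j = 0 then u i else if j = m + 1 then v i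
           else if i = j then 1 else 0)"
  let ?B = "mat (m + 2) (m + 2) (\<lambda>(i, j). if j = 0 then (if i = 0 then det A else 0)
     else if j = m + 1 then (if i = m + 1 then det A else 0) else f i j)"
  let ?C = "mat (m + 1) (m + 1) (\<lambda>(i, j). if j = m then (if i = m then det A else 0)
     else f (i + 1) (j + 1))"
  have minors: "mat_delete A 0 0 = mat (m + 1) (m + 1) (\<lambda>(i, j). f (i + 1) (j + 1))"
    "mat_delete A (m + 1) (m + 1) = mat (m + 1) (m + 1) (\<lambda>(i, j). f i j)"
    "mat_delete A 0 (m + 1) = mat (m + 1) (m + 1) (\<lambda>(i, j). f (i + 1) j)"
    "mat_delete A (m + 1) 0 = mat (m + 1) (m + 1) (\<lambda>(i, j). f i (j + 1))"
    by (rule eq_matI; simp add: mat_delete_def A_def)+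
  \<comment> \<open>The signs \<open>(- 1) ^ (m + 1)\<close> of the two off-diagonal corner
    cofactors cancel in their product.\<close>
  have sq: "(- 1) ^ n * x * ((- 1) ^ n * y) = x * y" for n and x y :: 'a
    by (simp add: mult.left_commute mult.assoc flip: power_add mult_2)
  have dN: "det ?N = consecutive_minor f (m + 1) 1 1 * consecutive_minor f (m + 1) 0 0
      - consecutive_minor f (m + 1) 1 0 * consecutive_minor f (m + 1) 0 1"
  proof -
    have uv: "u i = cofactor A 0 i" "v i = cofactor A (m + 1) i" if "i < m + 2" for i
      using that by (auto simp: u_def v_def adj_mat_def A_def)
    have "u 0 = consecutive_minor f (m + 1) 1 1"
         "v (m + 1) = consecutive_minor f (m + 1) 0 0"
         "u (m + 1) = (- 1) ^ (m + 1) * consecutive_minor f (m + 1) 1 0"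
         "v 0 = (- 1) ^ (m + 1) * consecutive_minor f (m + 1) 0 1"
      using minors by (simp_all add: uv cofactor_def consecutive_minor_def flip: mult_2)
    then show ?thesis
      unfolding det_identity_with_end_columns by (simp only: sq) (simp add: mult.commute)
  qed
  have AN: "A * ?N = ?B"
  proof (rule eq_matI)
    fix i j assume "i < dim_row ?B" "j < dim_col ?B"
    then have i: "i < m + 2" and j: "j < m + 2" by simp_all
    have *: "(A * ?N) $$ (i, j) = (\<Sum>l<m + 2. A $$ (i, l) * ?N $$ (l, j))"
      using i j A by (simp add: scalar_prod_def atLeast0LessThan)
    have adj: "(\<Sum>l<m + 2. A $$ (i, l) * adj_mat A $$ (l, j)) = (if i = j then det A else 0)"
    proof -
      have "(A * adj_mat A) $$ (i, j) = (\<Sum>l<m + 2. A $$ (i, l) * adj_mat A $$ (l, j))"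
        using i j A adj_mat(1)[OF A] by (simp add: scalar_prod_def atLeast0LessThan)
      moreover have "(A * adj_mat A) $$ (i, j) = (if i = j then det A else 0)"
        using i j by (simp add: adj_mat(2)[OF A])
      ultimately show ?thesis by (rule trans[OF sym])
    qed
    \<comment> \<open>In an end column the adjugate produces the determinant times a unit vector;
      every other column of A is copied.\<close>
    show "(A * ?N) $$ (i, j) = ?B $$ (i, j)"
    proof (cases "j = 0 \<or> j = m + 1")
      case True
      then have "(A * ?N) $$ (i, j) = (\<Sum>l<m + 2. A $$ (i, l) * adj_mat A $$ (l, j))"
        unfolding * by (intro sum.cong) (auto simp: u_def v_def)
      then show ?thesis using True i j adj by auto
    next
      case False
      then have "(A * ?N) $$ (i, j) = (\<Sum>l<m + 2. if l = j then A $$ (i, l) else 0)"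
        unfolding * using j by (intro sum.cong) auto
      then show ?thesis using False i j by (simp add: A_def)
    qed
  qed (use A in simp_all)
  have dB: "mat_delete ?B 0 0 = ?C"
    by (rule eq_matI) (auto simp: mat_delete_def)
  have dC: "mat_delete ?C m m = mat m m (\<lambda>(i, j). f (i + 1) (j + 1))"
    by (rule eq_matI) (auto simp: mat_delete_def)
  have "det ?B = ?B $$ (0, 0) * cofactor ?B 0 0"
    by (rule det_reduce_column[where n = "m + 2"]) auto
  also have "\<dots> = det A * det ?C" using dB by (simp add: cofactor_def)
  also have "det ?C = ?C $$ (m, m) * cofactor ?C m m"
    by (rule det_reduce_column[where n = "m + 1"]) auto
  also have "\<dots> = det A * consecutive_minor f m 1 1"
    using dC by (simp add: cofactor_def consecutive_minor_def flip: mult_2)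
  finally have "det A * det ?N = det A * (det A * consecutive_minor f m 1 1)"
    using AN det_mult[of A "m + 2" ?N] A by simp
  moreover have "det A = consecutive_minor f (m + 2) 0 0"
    by (simp add: A_def consecutive_minor_def)
  ultimately show ?thesis unfolding dN by simp
qed

text \<open>Since p is monic, the top coefficient of \<open>p * (q - r)\<close> is that of
  \<open>q - r\<close>, even if the coefficient ring has zero divisors.\<close>

lemma monic_mult_left_cancel:
  fixes p q r :: "'a :: comm_ring_1 poly"
  assumes "lead_coeff p = 1" "p * q = p * r"
  shows "q = r"
proof (rule ccontr)
  assume "q \<noteq> r"
  have "coeff (p * (q - r)) (degree p + degree (q - r)) = lead_coeff (q - r)"
    unfolding coeff_mult_degree_sum by (simp add: assms(1))
  moreover have "p * (q - r) = 0" using assms(2) by (simp add: algebra_simps)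
  ultimately have "lead_coeff (q - r) = 0" by simp
  then show False using \<open>q \<noteq> r\<close> by (simp only: leading_coeff_0_iff right_minus_eq)
qed

theorem desnanot_jacobi:
  fixes f :: "nat \<Rightarrow> nat \<Rightarrow> 'a :: comm_ring_1"
  shows "consecutive_minor f (m + 1) 1 1 * consecutive_minor f (m + 1) 0 0
           - consecutive_minor f (m + 1) 1 0 * consecutive_minor f (m + 1) 0 1
       = consecutive_minor f (m + 2) 0 0 * consecutive_minor f m 1 1"
proof -
  \<comment> \<open>To cancel the determinant in a ring with zero divisors, add an indeterminate on the diagonal:
    the determinant becomes a characteristic polynomial, which is monic.\<close>
  define F where "F i j = (if i = j then [:f i j, 1:] else [:f i j:])" for i j
  \<comment> \<open>Evaluation at 0 is a ring homomorphism that takes F back to f, and determinants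
    commute with it.\<close>
  have eval: "consecutive_minor f n r c = poly (consecutive_minor F n r c) 0" for n r c
  proof -
    have h: "comm_ring_hom (\<lambda>p :: 'a poly. poly p 0)" by unfold_locales simp_all
    have "map_mat (\<lambda>p. poly p 0) (mat n n (\<lambda>(i, j). F (i + r) (j + c)))
        = mat n n (\<lambda>(i, j). f (i + r) (j + c))"
      by (rule eq_matI) (auto simp: F_def)
    then show ?thesis unfolding consecutive_minor_def comm_ring_hom.hom_det[OF h, symmetric] by simp
  qed
  \<comment> \<open>\<open>char_poly_matrix\<close> subtracts its argument from the indeterminate on
    the diagonal, hence the entries \<open>- f i j\<close>.\<close>
  have "mat n n (\<lambda>(i, j). F i j) = char_poly_matrix (mat n n (\<lambda>(i, j). - f i j))" for n
    by (rule eq_matI) (auto simp: char_poly_matrix_def F_def)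
  then have "consecutive_minor F n 0 0 = char_poly (mat n n (\<lambda>(i, j). - f i j))" for n
    by (simp add: consecutive_minor_def char_poly_def)
  then have "lead_coeff (consecutive_minor F n 0 0) = 1" for n
    using degree_monic_char_poly[of "mat n n (\<lambda>(i, j). - f i j)" n] by simp
  from monic_mult_left_cancel[OF this desnanot_jacobi_times_det]
  show ?thesis unfolding eval by (metis poly_diff poly_mult)
qed

section \<open>Anticommutation relations\<close>

lemma fock_eq_neg_self_iff: "v = - v \<longleftrightarrow> v = (0 :: fock)"
proof
  assume *: "v = - v"
  show "v = 0"
  proof (rule poly_mapping_eqI)
    fix S
    have "Poly_Mapping.lookup v S = - Poly_Mapping.lookup v S"
      using arg_cong[OF *, of "\<lambda>v. Poly_Mapping.lookup v S"] by simp
    then show "Poly_Mapping.lookup v S = Poly_Mapping.lookup 0 S" by simp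
  qed
qed simp

lemma wsign_remove_above: "m < n \<Longrightarrow> wsign m (Maya (occ S - {n})) = wsign m S"
  unfolding wsign_def occ_remove by (rule arg_cong[where f = "\<lambda>A. (- 1) ^ card A"]) auto

lemma wsign_remove_below:
  assumes "m < n" "m \<in> occ S"
  shows "wsign n (Maya (occ S - {m})) = - wsign n S"
proof -
  have "m \<notin> occ (Maya (occ S - {m}))" by simp
  from wsign_insert_below[OF assms(1) this] show ?thesis
    using assms(2) by (simp add: insert_absorb occ_inverse)
qed

text \<open>For m < n the sign of n counts a factor m in front of it, while the sign of m ignores n,
  so the two orders differ by one factor -1. Both sides vanish for m = n.\<close>

lemma contract_anticomm: "contract m (contract n v) = - contract n (contract m v)"
proof -
  have *: "contract m (contract n v) = - contract n (contract m v)" if mn: "m < n" for m n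
  proof (rule flinear_eqI[where f = "\<lambda>v. contract m (contract n v)"
        and g = "\<lambda>v. - contract n (contract m v)"])
    show "flinear (\<lambda>v. contract m (contract n v))" "flinear (\<lambda>v. - contract n (contract m v))"
      by (rule flinear_comp[OF flinear_contract flinear_contract]
          flinear_minus[OF flinear_comp[OF flinear_contract flinear_contract]])+
    fix S
    show "contract m (contract n (ket S)) = - contract n (contract m (ket S))"
    proof (cases "m \<in> occ S \<and> n \<in> occ S")
      case False
      then show ?thesis
        by (cases "m \<in> occ S"; cases "n \<in> occ S")
           (simp_all add: contract_ket contract_ket_0 flinearD[OF flinear_contract])
    next
      case True
      with mn have "m \<in> occ (Maya (occ S - {n}))" "n \<in> occ (Maya (occ S - {m}))" by auto
      then have "contract m (contract n (ket S)) =
            fscale (wsign n S * wsign m S) (ket (Maya (occ S - {n} - {m})))"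
          "contract n (contract m (ket S)) =
            fscale (- (wsign n S * wsign m S)) (ket (Maya (occ S - {m} - {n})))"
        using True mn
        by (simp_all add: contract_ket flinearD[OF flinear_contract] wsign_remove_above
            wsign_remove_below mult.commute)
      moreover have "occ S - {n} - {m} = occ S - {m} - {n}" by auto
      ultimately show ?thesis by simp
    qed
  qed
  have eq: "contract n (contract n v) = - contract n (contract n v)"
  proof (rule flinear_eqI[where f = "\<lambda>v. contract n (contract n v)"
        and g = "\<lambda>v. - contract n (contract n v)"])
    show "flinear (\<lambda>v. contract n (contract n v))" "flinear (\<lambda>v. - contract n (contract n v))"
      by (rule flinear_comp[OF flinear_contract flinear_contract]
          flinear_minus[OF flinear_comp[OF flinear_contract flinear_contract]])+
    show "contract n (contract n (ket S)) = - contract n (contract n (ket S))" for S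
      by (cases "n \<in> occ S")
         (simp_all add: contract_ket contract_ket_0 flinearD[OF flinear_contract])
  qed
  show ?thesis
  proof (cases m n rule: linorder_cases)
    case less
    then show ?thesis by (rule *)
  next
    case equal
    show ?thesis unfolding equal by (rule eq)
  next
    case greater
    from *[OF this] show ?thesis by (metis minus_minus)
  qed
qed

text \<open>Only the sign of the larger index counts the factor at the smaller one, and the presence
  of that factor differs between the two orders.\<close>

lemma contract_wedge_anticomm:
  assumes "m \<noteq> n"
  shows "contract m (wedge n v) = - wedge n (contract m v)"
proof (rule flinear_eqI[where f = "\<lambda>v. contract m (wedge n v)"
      and g = "\<lambda>v. - wedge n (contract m v)"])
  show "flinear (\<lambda>v. contract m (wedge n v))" "flinear (\<lambda>v. - wedge n (contract m v))"
    by (rule flinear_comp[OF flinear_contract flinear_wedge]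
        flinear_minus[OF flinear_comp[OF flinear_wedge flinear_contract]])+
  fix S
  show "contract m (wedge n (ket S)) = - wedge n (contract m (ket S))"
  proof (cases "m \<in> occ S \<and> n \<notin> occ S")
    case False
    with assms show ?thesis
      by (cases "m \<in> occ S"; cases "n \<in> occ S")
         (simp_all add: contract_ket contract_ket_0 wedge_ket wedge_ket_0
           flinearD[OF flinear_contract] flinearD[OF flinear_wedge])
  next
    case True
    with assms have "m \<in> occ (Maya (insert n (occ S)))" "n \<notin> occ (Maya (occ S - {m}))" by auto
    then have *: "contract m (wedge n (ket S)) =
          fscale (wsign n S * wsign m (Maya (insert n (occ S))))
            (ket (Maya (insert n (occ S) - {m})))"
        "wedge n (contract m (ket S)) =
          fscale (wsign m S * wsign n (Maya (occ S - {m}))) (ket (Maya (insert n (occ S - {m}))))"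
      using True by (simp_all add: contract_ket wedge_ket flinearD[OF flinear_contract]
          flinearD[OF flinear_wedge])
    have "wsign n S * wsign m (Maya (insert n (occ S)))
        = - (wsign m S * wsign n (Maya (occ S - {m})))"
      using True assms by (cases m n rule: linorder_cases)
        (simp_all add: wsign_insert_above wsign_insert_below wsign_remove_above wsign_remove_below)
    moreover have "insert n (occ S) - {m} = insert n (occ S - {m})" using assms by auto
    ultimately show ?thesis unfolding * by (simp add: fock.scale_minus_left)
  qed
qed

section \<open>The group element\<close>

text \<open>A generator empties an even place and fills an odd one, so by parity the contraction of
  one generator never meets the wedging of another.\<close>

lemma gen_eq: "gen (k, l) v = wedge (- 2 * k - 1) (contract (2 * l) v)"
proof -
  have "pos 1 (- k - 1) = - 2 * k - 1" "pos 0 (- (- l - 1) - 1) = 2 * l" by (simp_all add: pos_def)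
  then show ?thesis by (simp only: gen_def prod.case psi_plus_def psi_minus_def)
qed

lemma flinear_gen: "flinear (gen x)"
proof -
  have "gen x = (\<lambda>v. wedge (- 2 * fst x - 1) (contract (2 * snd x) v))"
    by (cases x) (simp add: gen_eq fun_eq_iff)
  then show ?thesis using flinear_comp[OF flinear_wedge flinear_contract] by simp
qed

text \<open>Bringing the wedgings to the left leaves two adjacent contractions, which anticommute.
  This sign later becomes the sign of a transposition.\<close>

lemma gen_exchange: "gen (k, l) (gen (k', l') v) = - gen (k, l') (gen (k', l) v)"
proof -
  have ne: "2 * l \<noteq> - 2 * k - 1" for k l :: int by presburger
  note neg = flinearD(4)[OF flinear_wedge] flinearD(4)[OF flinear_contract]
  have *: "gen (k, l) (gen (k', l') v)
      = - wedge (- 2 * k - 1) (wedge (- 2 * k' - 1) (contract (2 * l) (contract (2 * l') v)))"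
    for l l' unfolding gen_eq contract_wedge_anticomm[OF ne] neg ..
  show ?thesis
    unfolding * by (subst contract_anticomm) (simp only: neg)
qed

text \<open>Both the wedgings and the contractions change places, and the two signs cancel. A
  product of generators thus depends only on the multiset of their indices.\<close>

lemma gen_commute: "gen x (gen y v) = gen y (gen x v)"
proof -
  obtain k l k' l' where xy: "x = (k, l)" "y = (k', l')" by (cases x, cases y)
  have ne: "2 * l \<noteq> - 2 * k - 1" for k l :: int by presburger
  note neg = flinearD(4)[OF flinear_wedge] flinearD(4)[OF flinear_contract]
  have *: "gen (k, l) (gen (k', l') v)
      = - wedge (- 2 * k - 1) (wedge (- 2 * k' - 1) (contract (2 * l) (contract (2 * l') v)))"
    for k l k' l' unfolding gen_eq contract_wedge_anticomm[OF ne] neg ..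
  show ?thesis
    unfolding xy * by (subst contract_anticomm, subst wedge_anticomm) (simp only: neg minus_minus)
qed

lemma gen_square [simp]: "gen x (gen x v) = 0"
  using gen_exchange[of "fst x" "snd x" "fst x" "snd x" v] by (simp add: fock_eq_neg_self_iff)

section \<open>Evaluating the exponential series\<close>

interpretation gen: comp_fun_commute gen
  by standard (auto simp: fun_eq_iff gen_commute)

lemma flinear_fold_gen: "flinear (\<lambda>v. fold_mset gen v M)"
proof (induction M)
  case empty
  show ?case by (rule flinearI) simp_all
next
  case (add x M)
  then show ?case using flinear_comp[OF flinear_gen] by simp
qed

lemma card_set_mset_neq_size:
  assumes "card (set_mset M) \<noteq> size M"
  obtains x N where "M = add_mset x (add_mset x N)"
proof -
  have "\<exists>x. 1 < count M x"
  proof (rule ccontr)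
    assume "\<not> ?thesis"
    then have "count M x = 1" if "x \<in># M" for x
      using that by (metis Suc_lessI count_greater_zero_iff One_nat_def)
    then have "size M = card (set_mset M)" by (simp add: size_multiset_overloaded_eq)
    with assms show False by simp
  qed
  then obtain x where "1 < count M x" ..
  then have "x \<in># M" "x \<in># M - {#x#}" by (auto simp flip: count_greater_zero_iff)
  then have "M = add_mset x (add_mset x (M - {#x#} - {#x#}))" by (metis insert_DiffM)
  then show ?thesis by (rule that)
qed

text \<open>
  The factorials cancel: a monomial with distinct variables arises in \<open>n!\<close> orders, and one with a
  repeated variable contributes 0 since the terms of the exponent have square 0.
\<close>

lemma gexponent_power:
  "(gexponent ^^ n) (\<lambda>N. if N = {#} then v else 0) M
     = (if size M = n then fscale (fact n) (fold_mset gen v M) else 0)"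
proof (induction n arbitrary: M)
  case 0
  show ?case by simp
next
  case (Suc n)
  let ?d = "\<lambda>N. if N = {#} then v else 0"
  have "(gexponent ^^ Suc n) ?d M = (\<Sum>x\<in>set_mset M. gen x ((gexponent ^^ n) ?d (M - {#x#})))"
    by (simp add: gexponent_def)
  also have "\<dots> = (\<Sum>x\<in>set_mset M. if size M = Suc n then fscale (fact n) (fold_mset gen v M) else 0)"
  proof (rule sum.cong)
    fix x assume x: "x \<in># M"
    then have "gen x (fold_mset gen v (M - {#x#})) = fold_mset gen v M"
      using gen.fold_mset_add_mset[of v x "M - {#x#}"] by simp
    moreover have "size (M - {#x#}) = n \<longleftrightarrow> size M = Suc n"
      using x by (metis size_Suc_Diff1 nat.inject)
    ultimately show "gen x ((gexponent ^^ n) ?d (M - {#x#}))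
        = (if size M = Suc n then fscale (fact n) (fold_mset gen v M) else 0)"
      by (simp add: Suc.IH flinearD[OF flinear_gen])
  qed simp
  also have "\<dots> = (if size M = Suc n then fscale (fact (Suc n)) (fold_mset gen v M) else 0)"
  \<comment> \<open>The sum has one term per distinct variable; these are n + 1 equal terms only if
    no variable is repeated.\<close>
  proof (cases "card (set_mset M) = size M")
    case True
    have "(\<Sum>x\<in>A. w) = fscale (of_nat (card A)) w" for A :: "(int \<times> int) set" and w
      by (rule poly_mapping_eqI) (simp add: lookup_sum)
    with True show ?thesis by (simp add: algebra_simps)
  next
    case False
    then obtain x N where "M = add_mset x (add_mset x N)" by (rule card_set_mset_neq_size)
    then have "fold_mset gen v M = 0" by simp
    then show ?thesis by simp
  qed
  finally show ?case .
qed

text \<open>The exponent raises the degree by one, so only the power \<open>size M\<close> reaches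
  M, and its factorial cancels that of the series.\<close>

lemma gact_eq_fold_mset: "gact v M = fold_mset gen v M"
proof -
  have "gact v M = (\<Sum>n\<le>size M. if n = size M then fold_mset gen v M else 0)"
    unfolding gact_def gexponent_power by (rule sum.cong) auto
  then show ?thesis by simp
qed


section \<open>Conjugation by the translation operators\<close>

text \<open>This is (-1)^a for an integer exponent, since translation operators also occur with
  negative powers.\<close>

definition psign :: "int \<Rightarrow> int"
  where "psign a = (if even a then 1 else - 1)"

text \<open>A relation that passes to compositions and inverses, with s, p and q additive, so that
  powers of \<open>Q0\<close> and \<open>Q1\<close> reduce to the operators themselves. Linearity
  and bijectivity are part of it to make this work.\<close>

definition intertwines_gen :: "(fock \<Rightarrow> fock) \<Rightarrow> int \<Rightarrow> int \<Rightarrow> int \<Rightarrow> bool"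
  where "intertwines_gen Q s p q \<longleftrightarrow> flinear Q \<and> bij Q \<and>
           (\<forall>k l v. Q (gen (k, l) v) = fscale (of_int (psign s)) (gen (k + p, l + q) (Q v)))"

lemma psign_add: "psign (a + b) = psign a * psign b"
  by (simp add: psign_def)

lemma psign_square [simp]: "psign a * psign a = 1"
  by (simp add: psign_def)

lemma intertwines_gen_id: "intertwines_gen id 0 0 0"
  by (auto simp: intertwines_gen_def psign_def intro!: flinearI)

lemma intertwines_gen_comp:
  assumes "intertwines_gen Q s p q" "intertwines_gen Q' s' p' q'"
  shows "intertwines_gen (Q \<circ> Q') (s + s') (p + p') (q + q')"
proof -
  have Q: "flinear Q" "bij Q" and Q': "flinear Q'" "bij Q'"
    using assms by (auto simp: intertwines_gen_def)
  have "flinear (Q \<circ> Q')" using flinear_comp[OF Q(1) Q'(1)] by (simp add: comp_def)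
  moreover have "bij (Q \<circ> Q')" using Q'(2) Q(2) by (rule bij_comp)
  ultimately show ?thesis
    using assms flinearD(2)[OF Q(1)]
    by (simp add: intertwines_gen_def psign_add mult.commute algebra_simps)
qed

lemma flinear_inv:
  assumes "flinear Q" "bij Q"
  shows "flinear (inv Q)"
proof (rule flinearI)
  have inj: "x = y" if "Q x = Q y" for x y
    using that bij_is_inj[OF assms(2)] by (simp add: inj_eq)
  have i [simp]: "Q (inv Q x) = x" for x using assms(2) by (simp add: bij_is_surj surj_f_inv_f)
  show "inv Q (u + v) = inv Q u + inv Q v" for u v
    by (rule inj) (simp add: flinearD[OF assms(1)])
  show "inv Q (fscale c v) = fscale c (inv Q v)" for c v
    by (rule inj) (simp add: flinearD[OF assms(1)])
qed

lemma intertwines_gen_inv: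
  assumes "intertwines_gen Q s p q"
  shows "intertwines_gen (inv Q) (- s) (- p) (- q)"
proof -
  have Q: "flinear Q" "bij Q" using assms by (auto simp: intertwines_gen_def)
  have i [simp]: "Q (inv Q x) = x" "inv Q (Q x) = x" for x
    using Q(2) by (simp_all add: bij_is_surj surj_f_inv_f bij_is_inj)
  have "inv Q (gen (k, l) v) = fscale (of_int (psign s)) (gen (k - p, l - q) (inv Q v))" for k l v
  proof -
    have "Q (fscale (of_int (psign s)) (gen (k - p, l - q) (inv Q v)))
        = fscale (of_int (psign s * psign s)) (gen (k, l) v)"
      using assms by (simp add: intertwines_gen_def flinearD(2)[OF Q(1)] del: psign_square)
    also have "\<dots> = gen (k, l) v" by (simp only: psign_square of_int_1 fock.scale_one)
    finally show ?thesis by (metis i(2))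
  qed
  then show ?thesis
    using flinear_inv[OF Q] bij_imp_bij_inv[OF Q(2)] by (simp add: intertwines_gen_def psign_def)
qed

lemma intertwines_gen_funpow:
  "intertwines_gen Q s p q \<Longrightarrow> intertwines_gen (Q ^^ n) (int n * s) (int n * p) (int n * q)"
proof (induction n)
  case 0
  show ?case using intertwines_gen_id by (simp only: funpow.simps(1) of_nat_0 mult_zero_left)
next
  case (Suc n)
  have "int (Suc n) * a = a + int n * a" for a by (simp add: algebra_simps)
  with intertwines_gen_comp[OF Suc.prems Suc.IH[OF Suc.prems]] show ?case
    by (simp only: funpow.simps(2))
qed

lemma intertwines_gen_int_iter:
  assumes "intertwines_gen Q s p q"
  shows "intertwines_gen (int_iter Q a) (a * s) (a * p) (a * q)"
proof (cases "0 \<le> a")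
  case True
  then show ?thesis using intertwines_gen_funpow[OF assms, of "nat a"] by (simp add: int_iter_def)
next
  case False
  then show ?thesis
    using intertwines_gen_funpow[OF intertwines_gen_inv[OF assms], of "nat (- a)"]
    by (simp add: int_iter_def)
qed

section \<open>Moving the translation operators past the generators\<close>

lemma Q_basics:
  shows "flinear Q0" "bij Q0" "flinear Q1" "bij Q1"
    and "Q0 v0 = psi_plus 0 (- 1) v0" "inv Q0 v0 = psi_minus 0 (- 1) v0"
    and "Q1 v0 = psi_plus 1 (- 1) v0" "inv Q1 v0 = psi_minus 1 (- 1) v0"
    and "shifts_field 0 Q0" "anticommutes_field 1 Q0" "shifts_field 1 Q1" "anticommutes_field 0 Q1"
    and "Q0 (Q1 v) = - Q1 (Q0 v)"
  using translation_ops_Q unfolding translation_ops_def by blast+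

lemma fscale_minus_one: "fscale (- 1) v = - v"
  by (simp add: fock.scale_minus_left)

text \<open>The wedging of type 1 anticommutes with \<open>Q0\<close>, which gives the sign; the
  contraction of type 0 has its mode shifted.\<close>

lemma intertwines_gen_Q0: "intertwines_gen Q0 1 0 (- 1)"
proof -
  have "Q0 (gen (k, l) v) = - gen (k, l - 1) (Q0 v)" for k l v
  proof -
    have "psi_plus 1 (- k - 1) (Q0 (psi_minus 0 (- l - 1) v))
        = - Q0 (psi_plus 1 (- k - 1) (psi_minus 0 (- l - 1) v))"
      using Q_basics(10) unfolding anticommutes_field_def by blast
    moreover have "psi_minus 0 (- l) (Q0 v) = Q0 (psi_minus 0 (- l - 1) v)"
      using Q_basics(9) unfolding shifts_field_def by blast
    ultimately show ?thesis by (simp add: gen_def)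
  qed
  then show ?thesis using Q_basics(1,2)
    by (simp add: intertwines_gen_def psign_def fscale_minus_one)
qed

text \<open>The roles are reversed: the contraction gives the sign and the wedging the
  shift.\<close>

lemma intertwines_gen_Q1: "intertwines_gen Q1 1 1 0"
proof -
  have "Q1 (gen (k, l) v) = - gen (k + 1, l) (Q1 v)" for k l v
  proof -
    have "psi_plus 1 (- k - 2) (Q1 (psi_minus 0 (- l - 1) v))
        = Q1 (psi_plus 1 (- k - 2 + 1) (psi_minus 0 (- l - 1) v))"
      using Q_basics(11) unfolding shifts_field_def by blast
    moreover have "- k - 2 + 1 = - k - 1" "- (k + 1) - 1 = - k - 2" by simp_all
    moreover have "psi_minus 0 (- l - 1) (Q1 v) = - Q1 (psi_minus 0 (- l - 1) v)"
      using Q_basics(12) unfolding anticommutes_field_def by blast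
    moreover have "psi_plus 1 a (- w) = - psi_plus 1 a w" for a w
      unfolding psi_plus_def by (rule flinearD(4)[OF flinear_wedge])
    ultimately show ?thesis by (simp only: gen_def prod.case minus_minus)
  qed
  then show ?thesis using Q_basics(3,4)
    by (simp add: intertwines_gen_def psign_def fscale_minus_one)
qed

lemma intertwines_gen_Qpow: "intertwines_gen (Qpow \<alpha> \<beta>) (\<alpha> + \<beta>) \<beta> (- \<alpha>)"
  using intertwines_gen_comp[OF intertwines_gen_int_iter[OF intertwines_gen_Q0, of \<alpha>]
      intertwines_gen_int_iter[OF intertwines_gen_Q1, of \<beta>]]
  by (simp add: Qpow_def)

definition shift_pairs :: "int \<Rightarrow> int \<Rightarrow> cmonomial \<Rightarrow> cmonomial"
  where "shift_pairs p q = image_mset (\<lambda>(k, l). (k + p, l + q))"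

lemma intertwines_gen_fold:
  assumes "intertwines_gen Q s p q"
  shows "Q (fold_mset gen v M)
    = fscale (of_int (psign s ^ size M)) (fold_mset gen (Q v) (shift_pairs p q M))"
proof (induction M)
  case empty
  show ?case by (simp add: shift_pairs_def)
next
  case (add x M)
  obtain k l where x: "x = (k, l)" by (cases x)
  have "Q (fold_mset gen v (add_mset x M))
      = fscale (of_int (psign s)) (gen (k + p, l + q) (Q (fold_mset gen v M)))"
    using assms by (simp add: x intertwines_gen_def)
  then show ?case
    by (simp add: add.IH x shift_pairs_def flinearD[OF flinear_gen])
qed

text \<open>By \<open>gact_eq_fold_mset\<close> this is the coefficient of a monomial in g applied
  to the vacuum.\<close>

definition excited :: "cmonomial \<Rightarrow> fock"
  where "excited = fold_mset gen v0"

lemma excited_simps [simp]: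
  "excited {#} = v0" "excited (add_mset x M) = gen x (excited M)"
  by (simp_all add: excited_def)

text \<open>Conjugation returns the vacuum to itself, so \<alpha> and \<beta> survive only as a
  shift of the indices and one sign per variable.\<close>

lemma Qpow_gact:
  "Qpow \<alpha> \<beta> (gact (inv (Qpow \<alpha> \<beta>) v0) M)
     = fscale (of_int (psign (\<alpha> + \<beta>) ^ size M)) (excited (shift_pairs \<beta> (- \<alpha>) M))"
proof -
  have "bij (Qpow \<alpha> \<beta>)" using intertwines_gen_Qpow by (simp add: intertwines_gen_def)
  then have "Qpow \<alpha> \<beta> (inv (Qpow \<alpha> \<beta>) v0) = v0" by (simp add: bij_is_surj surj_f_inv_f)
  then show ?thesis
    by (simp add: gact_eq_fold_mset intertwines_gen_fold[OF intertwines_gen_Qpow] excited_def)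
qed

section \<open>The translated vacua\<close>

text \<open>The monomial that p contributes to the Leibniz expansion of the determinant of the c(i,
  j) with 0 \<le> i, j < n.\<close>

definition perm_pairs :: "(nat \<Rightarrow> nat) \<Rightarrow> nat \<Rightarrow> cmonomial"
  where "perm_pairs p n = image_mset (\<lambda>i. (int i, int (p i))) (mset_set {0..<n})"

text \<open>The sign (-1)^(n(n+1)/2) of T^n v0 relative to its product of generators.\<close>

definition triangular_sign :: "nat \<Rightarrow> int"
  where "triangular_sign n = (- 1) ^ (\<Sum>i\<le>n. i)"

lemma triangular_sign_square [simp]: "triangular_sign n * triangular_sign n = 1"
  by (simp add: triangular_sign_def flip: power_mult_distrib)

lemma triangular_sign_Suc: "triangular_sign (Suc n) = (- 1) ^ Suc n * triangular_sign n"
  by (simp add: triangular_sign_def power_add)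

text \<open>The exponents differ by the odd number 2n + 3. This -1 turns the difference in the
  Desnanot--Jacobi identity into the sum in the theorem.\<close>

lemma triangular_sign_add_2: "triangular_sign (n + 2) * triangular_sign n = - 1"
proof -
  have "triangular_sign (n + 2) * triangular_sign n
      = - ((- 1) ^ n * (- 1) ^ n) * (triangular_sign n * triangular_sign n)"
    by (simp add: triangular_sign_Suc)
  then show ?thesis by (simp flip: power_mult_distrib)
qed

text \<open>The pair is split off at the front because a further translation shifts all present
  indices by one and creates the pair (0, 0).\<close>

lemma perm_pairs_id_Suc: "perm_pairs id (Suc n) = add_mset (0, 0) (shift_pairs 1 1 (perm_pairs id n))"
proof -
  have "mset_set {0..<Suc n} = add_mset 0 (image_mset Suc (mset_set {0..<n}))"
    by (simp add: image_mset_mset_set atLeast0_lessThan_Suc_eq_insert_0 image_iff)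
  then show ?thesis
    by (simp add: perm_pairs_def shift_pairs_def image_mset.compositionality comp_def add.commute)
qed

lemma inv_Q0_Q1: "inv Q0 (Q1 v) = - Q1 (inv Q0 v)"
proof -
  have i [simp]: "Q0 (inv Q0 x) = x" "inv Q0 (Q0 x) = x" for x
    using Q_basics(2) by (simp_all add: bij_is_surj surj_f_inv_f bij_is_inj)
  have "Q0 (- Q1 (inv Q0 v)) = Q1 v"
    by (simp add: flinearD(4)[OF Q_basics(1)] Q_basics(13))
  then show ?thesis by (metis i(2))
qed

text \<open>Writing \<open>Q1 v0\<close> as a wedging and moving it past the inverse of
  \<open>Q0\<close> costs the sign. This is the generator that each translation creates.\<close>

lemma inv_Q0_Q1_v0: "inv Q0 (Q1 v0) = - gen (0, 0) v0"
proof -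
  have i: "Q0 (inv Q0 x) = x" "inv Q0 (Q0 x) = x" for x
    using Q_basics(2) by (simp_all add: bij_is_surj surj_f_inv_f bij_is_inj)
  have "psi_plus 1 (- 1) (Q0 (inv Q0 v0)) = - Q0 (psi_plus 1 (- 1) (inv Q0 v0))"
    using Q_basics(10) unfolding anticommutes_field_def by blast
  then have "Q0 (- psi_plus 1 (- 1) (inv Q0 v0)) = Q1 v0"
    by (simp only: i Q_basics(7) flinearD(4)[OF Q_basics(1)])
  then have "inv Q0 (Q1 v0) = - psi_plus 1 (- 1) (inv Q0 v0)" by (metis i(2))
  then show ?thesis by (simp add: Q_basics(6) gen_def)
qed

text \<open>The step from n to n + 1 contributes (-1)^n from reordering translation operators and -1
  from the new generator; these signs multiply up to the triangular sign.\<close>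

lemma Tpow_v0: "Tpow (int n) v0 = fscale (of_int (triangular_sign n)) (excited (perm_pairs id n))"
proof -
  have T: "Tpow (int n) = inv Q0 ^^ n \<circ> Q1 ^^ n" for n
    by (cases n) (simp_all add: Tpow_def int_iter_def nat_add_distrib)
  have lin: "flinear (inv Q0)" by (rule flinear_inv[OF Q_basics(1,2)])
  have comm: "(inv Q0 ^^ n) (Q1 v) = fscale ((- 1) ^ n) (Q1 ((inv Q0 ^^ n) v))" for n v
    by (induction n) (simp_all add: flinearD[OF lin] inv_Q0_Q1 fock.scale_minus_left)
  have X: "intertwines_gen (inv Q0 \<circ> Q1) 0 1 1"
    using intertwines_gen_comp[OF intertwines_gen_inv[OF intertwines_gen_Q0] intertwines_gen_Q1]
    by simp
  show ?thesis
  proof (induction n)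
    case 0
    show ?case using T[of 0] by (simp add: triangular_sign_def perm_pairs_def)
  next
    case (Suc n)
    have "Tpow (int (Suc n)) v0 = inv Q0 ((inv Q0 ^^ n) (Q1 ((Q1 ^^ n) v0)))"
      by (simp only: T) simp
    \<comment> \<open>One \<open>Q1\<close> moves left past n copies of \<open>inv Q0\<close>, which
      splits off \<open>inv Q0 \<circ> Q1\<close>.\<close>
    also have "\<dots> = fscale ((- 1) ^ n) ((inv Q0 \<circ> Q1) (Tpow (int n) v0))"
      unfolding comm by (simp add: flinearD[OF lin] T)
    also have "(inv Q0 \<circ> Q1) (Tpow (int n) v0)
        = fscale (of_int (triangular_sign n)) ((inv Q0 \<circ> Q1) (excited (perm_pairs id n)))"
      unfolding Suc.IH by (simp add: flinearD[OF lin] flinearD[OF Q_basics(3)])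
    also have "(inv Q0 \<circ> Q1) (excited (perm_pairs id n))
        = fold_mset gen (- gen (0, 0) v0) (shift_pairs 1 1 (perm_pairs id n))"
      unfolding excited_def intertwines_gen_fold[OF X] by (simp add: inv_Q0_Q1_v0 psign_def)
    also have "\<dots> = - excited (perm_pairs id (Suc n))"
      by (simp add: flinearD(4)[OF flinear_fold_gen] perm_pairs_id_Suc excited_def
          gen.fold_mset_fun_left_comm)
    finally show ?case
      by (simp add: triangular_sign_def power_add fock.scale_minus_left mult.commute id_def)
  qed
qed

section \<open>Matrix elements\<close>

text \<open>The places occupied in \<open>excited M\<close>, provided that no generator annihilates
  the vector.\<close>

definition excited_occ :: "cmonomial \<Rightarrow> int set"
  where "excited_occ M = ({0..} - (\<lambda>x. 2 * snd x) ` set_mset M) \<union> (\<lambda>x. - 2 * fst x - 1) ` set_mset M"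

text \<open>Pairs are rooks in the quadrant of nonnegative rows and columns, no two attacking each
  other. Counting in the projected multisets also excludes a repeated pair.\<close>

definition rook_placement :: "cmonomial \<Rightarrow> bool"
  where "rook_placement M \<longleftrightarrow> (\<forall>x\<in>#M. 0 \<le> fst x \<and> 0 \<le> snd x) \<and>
     (\<forall>i. count (image_mset fst M) i \<le> 1) \<and> (\<forall>j. count (image_mset snd M) j \<le> 1)"

lemma rook_placement_add:
  "rook_placement (add_mset (k, l) M) \<longleftrightarrow> rook_placement M \<and> 0 \<le> k \<and> 0 \<le> l \<and>
     k \<notin> fst ` set_mset M \<and> l \<notin> snd ` set_mset M"
proof -
  have "(\<forall>i. count (add_mset a N) i \<le> 1) \<longleftrightarrow> (\<forall>i. count N i \<le> 1) \<and> a \<notin># N"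
    for a :: int and N
  proof (intro iffI conjI allI)
    fix i
    assume H: "\<forall>i. count (add_mset a N) i \<le> 1"
    show "count N i \<le> 1" using H[rule_format, of i] by (simp split: if_splits)
    show "a \<notin># N" using H[rule_format, of a] by (simp add: not_in_iff)
  next
    fix i
    assume "(\<forall>i. count N i \<le> 1) \<and> a \<notin># N"
    then show "count (add_mset a N) i \<le> 1" by (cases "i = a") (simp_all add: not_in_iff)
  qed
  then show ?thesis by (auto simp: rook_placement_def)
qed

lemma signed_ket_wedge_0: "signed_ket v A \<Longrightarrow> n \<in> A \<Longrightarrow> wedge n v = 0"
  and signed_ket_contract_0: "signed_ket v A \<Longrightarrow> n \<notin> A \<Longrightarrow> contract n v = 0"
  by (auto simp: signed_ket_def flinearD[OF flinear_wedge] flinearD[OF flinear_contract]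
      wedge_ket_0 contract_ket_0)

lemma signed_ket_v0: "signed_ket v0 {0..}"
  unfolding signed_ket_def v0_def by (rule exI[of _ 1], rule exI[of _ vac]) simp

lemma excited_occ_even: "2 * l \<in> excited_occ M \<longleftrightarrow> 0 \<le> l \<and> l \<notin> snd ` set_mset M"
proof -
  have "2 * l \<noteq> - 2 * k - 1" for k :: int by presburger
  then have "2 * l \<notin> (\<lambda>x. - 2 * fst x - 1) ` set_mset M" by blast
  moreover have "2 * l \<in> (\<lambda>x. 2 * snd x) ` set_mset M \<longleftrightarrow> l \<in> snd ` set_mset M" by force
  ultimately show ?thesis unfolding excited_occ_def Un_iff Diff_iff by simp
qed

lemma excited_occ_odd: "- 2 * k - 1 \<in> excited_occ M \<longleftrightarrow> k < 0 \<or> k \<in> fst ` set_mset M"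
proof -
  have "- 2 * k - 1 \<noteq> 2 * l" for l :: int by presburger
  then have "- 2 * k - 1 \<notin> (\<lambda>x. 2 * snd x) ` set_mset M" by blast
  moreover have "- 2 * k - 1 = - 2 * k' - 1 \<longleftrightarrow> k = k'" for k' by presburger
  then have "- 2 * k - 1 \<in> (\<lambda>x. - 2 * fst x - 1) ` set_mset M \<longleftrightarrow> k \<in> fst ` set_mset M"
    unfolding image_iff by blast
  moreover have "- 2 * k - 1 \<in> {0..} \<longleftrightarrow> k < 0" by auto
  ultimately show ?thesis unfolding excited_occ_def Un_iff Diff_iff by blast
qed

lemma excited_occ_add:
  "excited_occ (add_mset (k, l) M) = insert (- 2 * k - 1) (excited_occ M - {2 * l})"
proof -
  have "2 * l \<noteq> - 2 * k - 1" for k :: int by presburger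
  then have "2 * l \<notin> (\<lambda>x. - 2 * fst x - 1) ` set_mset M" by blast
  then show ?thesis unfolding excited_occ_def set_mset_add_mset_insert image_insert by auto
qed

text \<open>A generator acts nontrivially only if its even place is still occupied and its odd place
  still empty, which is the condition for adding a rook. Both outcomes are stated together so that
  one induction proves them.\<close>

lemma excited_cases:
  "if rook_placement M then signed_ket (excited M) (excited_occ M) else excited M = 0"
proof (induction M)
  case empty
  show ?case by (simp add: rook_placement_def excited_occ_def signed_ket_v0)
next
  case (add x M)
  obtain k l where x: "x = (k, l)" by (cases x)
  show ?case
  proof (cases "rook_placement M")
    case False
    with add.IH show ?thesis by (simp add: x rook_placement_add flinearD[OF flinear_gen])
  next
    case True
    with add.IH have sk: "signed_ket (excited M) (excited_occ M)" by simp
    have k_ne: "- 2 * k - 1 \<noteq> 2 * l" by presburger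
    show ?thesis
    proof (cases "2 * l \<in> excited_occ M")
      case False
      \<comment> \<open>Place 2l is empty because l is negative or column l is already
        taken.\<close>
      then have "contract (2 * l) (excited M) = 0" by (rule signed_ket_contract_0[OF sk])
      then have "excited (add_mset x M) = 0" by (simp add: x gen_eq flinearD[OF flinear_wedge])
      moreover have "\<not> rook_placement (add_mset x M)"
        using False unfolding excited_occ_even x rook_placement_add by blast
      ultimately show ?thesis by simp
    next
      case l_in: True
      from signed_ket_contract[OF sk this]
      have sk': "signed_ket (contract (2 * l) (excited M)) (excited_occ M - {2 * l})" .
      show ?thesis
      proof (cases "- 2 * k - 1 \<in> excited_occ M")
        case True
        \<comment> \<open>Place -2k - 1 is occupied because k is negative, as in the vacuum, or
          because row k is already taken.\<close>
        then have "- 2 * k - 1 \<in> excited_occ M - {2 * l}" using k_ne by blast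
        from signed_ket_wedge_0[OF sk' this] have "excited (add_mset x M) = 0"
          unfolding excited_simps x gen_eq .
        moreover have "\<not> rook_placement (add_mset x M)"
          using True unfolding excited_occ_odd x rook_placement_add by auto
        ultimately show ?thesis by simp
      next
        case False
        then have "- 2 * k - 1 \<notin> excited_occ M - {2 * l}" by blast
        from signed_ket_wedge[OF sk' this]
        have "signed_ket (excited (add_mset x M)) (excited_occ (add_mset x M))"
          unfolding excited_simps x gen_eq excited_occ_add .
        moreover have "rook_placement (add_mset x M)"
          using True False l_in unfolding excited_occ_odd excited_occ_even x rook_placement_add
          by auto
        ultimately show ?thesis by simp
      qed
    qed
  qed
qed

section \<open>Pairings of signed basis vectors\<close>

lemma form_fscale: "form (fscale a u) (fscale b v) = a * b * form u v"
proof -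
  have sup: "form u v = (\<Sum>S\<in>A. Poly_Mapping.lookup u S * Poly_Mapping.lookup v S)"
    if "finite A" "Poly_Mapping.keys u \<subseteq> A" for u v A
    unfolding form_def
    by (rule sum.mono_neutral_left) (use that in \<open>auto simp: in_keys_iff\<close>)
  have "form (fscale a u) (fscale b v) = (\<Sum>S\<in>Poly_Mapping.keys u.
      Poly_Mapping.lookup (fscale a u) S * Poly_Mapping.lookup (fscale b v) S)"
    by (rule sup) (auto simp: in_keys_iff)
  then show ?thesis by (simp add: form_def sum_distrib_left mult_ac)
qed

lemma form_signed_ket_self:
  assumes "signed_ket v A"
  shows "form v v = 1"
proof -
  obtain s S where "s = 1 \<or> s = - 1" and v: "v = fscale s (ket S)"
    using assms unfolding signed_ket_def by blast
  then show ?thesis unfolding v form_ket by auto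
qed

lemma form_signed_ket_neq:
  assumes "signed_ket u A" "signed_ket v B" "A \<noteq> B"
  shows "form u v = 0"
proof -
  obtain s S t T where u: "u = fscale s (ket S)" "occ S = A" and v: "v = fscale t (ket T)" "occ T = B"
    using assms unfolding signed_ket_def by blast
  then show ?thesis unfolding u(1) v(1) form_ket using assms(3) by auto
qed

lemma form_0_right [simp]: "form u 0 = 0"
  by (simp add: form_def)

section \<open>Permutation monomials and their signs\<close>

lemma rook_placement_perm_pairs:
  assumes "p permutes {0..<n}"
  shows "rook_placement (perm_pairs p n)"
proof -
  have "inj_on (\<lambda>i. int (p i)) {0..<n}"
    by (rule inj_onI) (use permutes_inj[OF assms] in \<open>auto dest: injD\<close>)
  then have "image_mset snd (perm_pairs p n) = mset_set ((\<lambda>i. int (p i)) ` {0..<n})"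
    "image_mset fst (perm_pairs p n) = mset_set (int ` {0..<n})"
    by (simp_all add: perm_pairs_def image_mset.compositionality comp_def image_mset_mset_set)
  then show ?thesis
    by (simp add: rook_placement_def count_mset_set') (simp add: perm_pairs_def)
qed

text \<open>The rooks in rows a and b exchange their columns, which is the sign change of
  \<open>gen_exchange\<close>; the others stay put.\<close>

lemma excited_perm_pairs_exchange:
  assumes "a < n" "b < n" "a \<noteq> b"
  shows "excited (perm_pairs (p \<circ> Transposition.transpose a b) n) = - excited (perm_pairs p n)"
proof -
  define R where "R = mset_set ({0..<n} - {a} - {b})"
  have s: "mset_set {0..<n} = add_mset a (add_mset b R)"
    using assms unfolding R_def
    by (subst mset_set.remove[of _ a], simp_all, subst mset_set.remove[of _ b]) simp_all
  have R: "image_mset (\<lambda>i. (int i, int ((p \<circ> Transposition.transpose a b) i))) R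
      = image_mset (\<lambda>i. (int i, int (p i))) R"
    by (rule image_mset_cong) (simp add: R_def Transposition.transpose_def)
  show ?thesis
    unfolding perm_pairs_def s using R
    by (simp add: gen_exchange[of "int a" "int (p b)"])
qed

lemma excited_perm_pairs:
  assumes "p permutes {0..<n}"
  shows "excited (perm_pairs p n) = fscale (of_int (sign p)) (excited (perm_pairs id n))"
  using finite_atLeastLessThan assms
proof (induction rule: permutes_rev_induct)
  case id
  show ?case by (simp add: sign_id)
next
  case (swap a b p)
  have "sign (p \<circ> Transposition.transpose a b) = - sign p"
    using swap.hyps permutation_permutes[of p]
    by (subst sign_compose) (auto simp: sign_swap_id permutation_swap_id intro: permutes_imp_permutation)
  moreover have "excited (perm_pairs (p \<circ> Transposition.transpose a b) n) = - excited (perm_pairs p n)"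
    by (rule excited_perm_pairs_exchange) (use swap.hyps in auto)
  ultimately show ?case by (simp only: swap.IH of_int_minus fock.scale_minus_left)
qed

text \<open>The vector of the identity is a basis vector up to a sign, which squares to 1 in the
  pairing.\<close>

lemma form_excited_perm_pairs:
  assumes "p permutes {0..<n}"
  shows "form (excited (perm_pairs id n)) (excited (perm_pairs p n)) = of_int (sign p)"
proof -
  have "signed_ket (excited (perm_pairs id n)) (excited_occ (perm_pairs id n))"
    using excited_cases[of "perm_pairs id n"] rook_placement_perm_pairs[OF permutes_id, of n] by simp
  from form_signed_ket_self[OF this] show ?thesis
    using form_fscale[of 1 "excited (perm_pairs id n)"] by (simp add: excited_perm_pairs[OF assms])
qed

text \<open>Rows and columns are recorded at places of different parity and can be read off
  separately; how they are matched is lost.\<close>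

lemma excited_occ_row_column:
  assumes "rook_placement M"
  shows "fst ` set_mset M = {k. 0 \<le> k \<and> - 2 * k - 1 \<in> excited_occ M}"
    and "snd ` set_mset M = {l. 0 \<le> l \<and> 2 * l \<notin> excited_occ M}"
  unfolding excited_occ_odd excited_occ_even
  using assms by (auto simp: rook_placement_def)

text \<open>With one rook per row the placement is the graph of a function, and as it fills all n
  columns this function is a bijection.\<close>

lemma rook_placement_eq_perm_pairs:
  assumes M: "rook_placement M"
    and rows: "fst ` set_mset M = {0..<int n}" and cols: "snd ` set_mset M = {0..<int n}"
  obtains p where "p permutes {0..<n}" "M = perm_pairs p n"
proof -
  have simple: "N = mset_set (set_mset N)" if "\<forall>i. count N i \<le> 1" for N :: "int multiset"
  proof (rule multiset_eqI)
    fix i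
    show "count N i = count (mset_set (set_mset N)) i"
      using that[rule_format, of i] by (cases "i \<in># N")
        (auto simp: not_in_iff simp flip: count_greater_zero_iff)
  qed
  have fstM: "image_mset fst M = mset_set {0..<int n}"
    using simple[of "image_mset fst M"] M rows by (simp add: rook_placement_def)
  have "inj_on fst (set_mset M)"
  proof (rule inj_onI, rule ccontr)
    fix x y assume xy: "x \<in># M" "y \<in># M" "fst x = fst y" "x \<noteq> y"
    then obtain N where "M = add_mset x (add_mset y N)"
      by (metis insert_DiffM insert_noteq_member)
    then have "2 \<le> count (image_mset fst M) (fst x)"
      using xy(3) by simp
    moreover have "count (image_mset fst M) (fst x) \<le> 1"
      using M by (simp add: rook_placement_def)
    ultimately show False by linarith
  qed
  define q where "q i = snd (the_inv_into (set_mset M) fst i)" for i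
  have q: "q (fst x) = snd x" if "x \<in># M" for x
    using that \<open>inj_on fst (set_mset M)\<close> by (simp add: q_def the_inv_into_f_f)
  have "M = image_mset (\<lambda>x. (fst x, q (fst x))) M"
    by (rule trans[OF _ image_mset_cong[of M "\<lambda>x. x"]]) (simp_all add: q)
  also have "\<dots> = image_mset (\<lambda>i. (i, q i)) (mset_set {0..<int n})"
    by (simp add: image_mset.compositionality comp_def flip: fstM)
  also have "{0..<int n} = int ` {0..<n}" by (simp add: image_int_atLeastLessThan)
  finally have Mq: "M = image_mset (\<lambda>i. (int i, q (int i))) (mset_set {0..<n})"
    by (simp add: image_mset.compositionality comp_def flip: image_mset_mset_set)
  \<comment> \<open>\<open>permutes\<close> demands the identity outside the range.\<close>
  define p where "p i = (if i < n then nat (q (int i)) else i)" for i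
  have im: "(\<lambda>i. q (int i)) ` {0..<n} = {0..<int n}"
    using cols unfolding Mq by (simp add: image_image)
  have p: "int (p i) = q (int i)" if "i < n" for i
  proof -
    have "q (int i) \<in> {0..<int n}" using that unfolding im[symmetric] by auto
    with that show ?thesis by (simp add: p_def)
  qed
  have "p ` {0..<n} = {0..<n}"
  proof -
    have "int ` p ` {0..<n} = int ` {0..<n}"
      using im by (simp add: image_image p image_int_atLeastLessThan)
    then show ?thesis by (simp add: inj_image_eq_iff)
  qed
  then have "bij_betw p {0..<n} {0..<n}"
    by (simp add: bij_betw_def eq_card_imp_inj_on)
  then have "p permutes {0..<n}" by (rule bij_imp_permutes) (simp add: p_def)
  moreover have "M = perm_pairs p n"
    unfolding perm_pairs_def by (subst Mq, rule image_mset_cong) (simp add: p)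
  ultimately show ?thesis by (rule that)
qed

text \<open>A nonzero pairing forces equal occupied places, hence rows and columns 0 to n - 1, each
  used once.\<close>

lemma form_excited_nonzeroE:
  assumes "form (excited (perm_pairs id n)) (excited M) \<noteq> 0"
  obtains p where "p permutes {0..<n}" "M = perm_pairs p n"
proof -
  let ?I = "perm_pairs id n"
  have I: "rook_placement ?I" by (rule rook_placement_perm_pairs[OF permutes_id])
  then have skI: "signed_ket (excited ?I) (excited_occ ?I)" using excited_cases[of ?I] by simp
  have M: "rook_placement M" using assms excited_cases[of M] by (auto split: if_splits)
  then have skM: "signed_ket (excited M) (excited_occ M)" using excited_cases[of M] by simp
  have "excited_occ M = excited_occ ?I" using form_signed_ket_neq[OF skI skM] assms by auto
  then have "fst ` set_mset M = fst ` set_mset ?I" "snd ` set_mset M = snd ` set_mset ?I"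
    using excited_occ_row_column[OF M] excited_occ_row_column[OF I] by simp_all
  moreover have "fst ` set_mset ?I = {0..<int n}" "snd ` set_mset ?I = {0..<int n}"
    by (simp_all add: perm_pairs_def image_image image_int_atLeastLessThan)
  ultimately show ?thesis by (metis rook_placement_eq_perm_pairs[OF M] that)
qed

lemma perm_pairs_inj:
  assumes "p permutes {0..<n}" "q permutes {0..<n}" "perm_pairs p n = perm_pairs q n"
  shows "p = q"
proof
  fix i
  show "p i = q i"
  proof (cases "i < n")
    case True
    then have "(int i, int (p i)) \<in># perm_pairs p n" by (auto simp: perm_pairs_def)
    then show ?thesis unfolding assms(3) by (auto simp: perm_pairs_def)
  next
    case False
    then show ?thesis using assms(1,2) by (simp add: permutes_not_in)
  qed
qed

section \<open>The tau functions as determinants\<close>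

lemma shift_pairs_inverse: "shift_pairs p q (shift_pairs (- p) (- q) M) = M"
  by (simp add: shift_pairs_def image_mset.compositionality comp_def case_prod_beta)

lemma shift_pairs_eq_iff: "shift_pairs p q M = N \<longleftrightarrow> M = shift_pairs (- p) (- q) N"
  using shift_pairs_inverse[of p q N] shift_pairs_inverse[of "- p" "- q" M] by auto

text \<open>For a one-element multiset this is the variable c(k, l) itself, as a scalar
  series.\<close>

definition cmono :: "cmonomial \<Rightarrow> cseries"
  where "cmono N = Series (\<lambda>M. if M = N then 1 else 0)"

lemma coefficient_Series [simp]: "coefficient (Series f) = f"
  by (simp add: Series_inverse)

lemma cseries_eqI: "(\<And>M. coefficient f M = coefficient g M) \<Longrightarrow> f = g"
  by (simp add: coefficient_inject[symmetric] fun_eq_iff)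

lemma coefficient_cmono: "coefficient (cmono N) M = (if M = N then 1 else 0)"
  by (simp add: cmono_def)

lemma coefficient_of_int_mult: "coefficient (of_int c * f) M = of_int c * coefficient f M"
proof (induction c rule: int_induct[where k = 0])
  case base
  show ?case by (simp add: zero_cseries.rep_eq)
next
  case (step1 i)
  then show ?case by (simp add: distrib_right plus_cseries.rep_eq)
next
  case (step2 i)
  then show ?case by (simp add: left_diff_distrib minus_cseries.rep_eq)
qed

lemma coefficient_sum: "coefficient (sum f A) M = (\<Sum>x\<in>A. coefficient (f x) M)"
  by (induction A rule: infinite_finite_induct) (simp_all add: zero_cseries.rep_eq plus_cseries.rep_eq)

lemma cmono_empty: "cmono {#} = 1"
  by (rule cseries_eqI) (simp add: coefficient_cmono one_cseries.rep_eq)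

lemma cmono_mult: "cmono A * cmono B = cmono (A + B)"
proof (rule cseries_eqI)
  fix M
  have "coefficient (cmono A * cmono B) M
      = (\<Sum>C | C \<subseteq># M. if C = A then (if M - A = B then 1 else 0) else 0)"
    unfolding times_cseries.rep_eq coefficient_cmono by (rule sum.cong) auto
  also have "\<dots> = (if A \<subseteq># M \<and> M - A = B then 1 else 0)"
    by (simp add: finite_submultisets)
  also have "A \<subseteq># M \<and> M - A = B \<longleftrightarrow> M = A + B"
    by (metis mset_subset_eq_add_left add_diff_cancel_left' subset_mset.add_diff_inverse)
  finally show "coefficient (cmono A * cmono B) M = coefficient (cmono (A + B)) M"
    by (simp add: coefficient_cmono)
qed

lemma prod_cmono_single:
  "(\<Prod>i\<in>A. cmono {#x i#}) = cmono (image_mset x (mset_set A))"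
  by (induction A rule: infinite_finite_induct) (simp_all add: cmono_empty cmono_mult)

lemma coefficient_tau:
  "coefficient (tau k \<alpha> \<beta>) M
     = of_int (psign (\<alpha> + \<beta>) ^ size M) * form (Tpow k v0) (excited (shift_pairs \<beta> (- \<alpha>) M))"
  using form_fscale[of 1 "Tpow k v0"] by (simp add: tau_def Qpow_gact)

text \<open>Coefficients are compared. Up to the sign in front, the pairing with T^n v0 is the sign
  of p if the shifted monomial belongs to a permutation p, and 0 otherwise, as in the Leibniz
  formula.\<close>

lemma tau_eq_det:
  "tau (int n) \<alpha> \<beta> = of_int (triangular_sign n * psign (\<alpha> + \<beta>) ^ n)
     * det (mat n n (\<lambda>(i, j). cmono {#(int i - \<beta>, int j + \<alpha>)#}))"
proof (rule cseries_eqI)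
  fix M
  let ?P = "{p. p permutes {0..<n}}"
  let ?N = "shift_pairs \<beta> (- \<alpha>) M"
  have prod: "(\<Prod>i = 0..<n. mat n n (\<lambda>(i, j). cmono {#(int i - \<beta>, int j + \<alpha>)#}) $$ (i, p i))
      = cmono (shift_pairs (- \<beta>) \<alpha> (perm_pairs p n))" if "p \<in> ?P" for p
  proof -
    have "p i < n" if "i < n" for i
      using permutes_in_image[of p "{0..<n}" i] that \<open>p \<in> ?P\<close> by simp
    then have "(\<Prod>i = 0..<n. mat n n (\<lambda>(i, j). cmono {#(int i - \<beta>, int j + \<alpha>)#}) $$ (i, p i))
        = (\<Prod>i = 0..<n. cmono {#(int i - \<beta>, int (p i) + \<alpha>)#})"
      by (intro prod.cong) auto
    then show ?thesis
      unfolding prod_cmono_single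
      by (simp add: shift_pairs_def perm_pairs_def image_mset.compositionality comp_def)
  qed
  have "det (mat n n (\<lambda>(i, j). cmono {#(int i - \<beta>, int j + \<alpha>)#}))
      = (\<Sum>p\<in>?P. of_int (sign p) * cmono (shift_pairs (- \<beta>) \<alpha> (perm_pairs p n)))"
    unfolding det_def using prod by (auto intro!: sum.cong)
  then have det: "coefficient (det (mat n n (\<lambda>(i, j). cmono {#(int i - \<beta>, int j + \<alpha>)#}))) M
      = (\<Sum>p\<in>?P. if ?N = perm_pairs p n then of_int (sign p) else 0)"
    by (auto simp: coefficient_sum coefficient_of_int_mult coefficient_cmono shift_pairs_eq_iff
        intro!: sum.cong)
  have sum: "(\<Sum>p\<in>?P. if ?N = perm_pairs p n then of_int (sign p) else 0)
      = form (excited (perm_pairs id n)) (excited ?N)"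
  proof (cases "\<exists>p\<in>?P. ?N = perm_pairs p n")
    case True
    then obtain p where p: "p permutes {0..<n}" "?N = perm_pairs p n" by auto
    have "(\<Sum>q\<in>?P. if ?N = perm_pairs q n then of_int (sign q) else 0)
        = (\<Sum>q\<in>?P. if q = p then of_int (sign q) else (0 :: complex))"
      using p perm_pairs_inj[of _ n p] by (intro sum.cong) auto
    also have "\<dots> = of_int (sign p)" using p(1) by (simp add: finite_permutations)
    finally show ?thesis using p by (simp add: form_excited_perm_pairs)
  next
    case False
    then have "form (excited (perm_pairs id n)) (excited ?N) = 0"
      using form_excited_nonzeroE[of n ?N] by blast
    moreover have "(\<Sum>p\<in>?P. if ?N = perm_pairs p n then of_int (sign p) else 0) = (0 :: complex)"
      using False by (intro sum.neutral) auto
    ultimately show ?thesis by simp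
  qed
  \<comment> \<open>The exponent \<open>size M\<close> of the conjugation sign may be replaced by n
    wherever the pairing is nonzero.\<close>
  have size: "size M = n" if nonzero: "form (excited (perm_pairs id n)) (excited ?N) \<noteq> 0"
  proof -
    obtain p where "?N = perm_pairs p n" using form_excited_nonzeroE[OF nonzero] by blast
    then have "size ?N = n" by (simp add: perm_pairs_def)
    then show ?thesis by (simp add: shift_pairs_def)
  qed
  have "coefficient (tau (int n) \<alpha> \<beta>) M = of_int (psign (\<alpha> + \<beta>) ^ size M)
      * (of_int (triangular_sign n) * form (excited (perm_pairs id n)) (excited ?N))"
    using form_fscale[of _ _ 1] by (simp add: coefficient_tau Tpow_v0)
  also have "\<dots> = of_int (triangular_sign n * psign (\<alpha> + \<beta>) ^ n)
      * form (excited (perm_pairs id n)) (excited ?N)"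
    using size by (cases "form (excited (perm_pairs id n)) (excited ?N) = 0") auto
  finally show "coefficient (tau (int n) \<alpha> \<beta>) M = coefficient (of_int (triangular_sign n
      * psign (\<alpha> + \<beta>) ^ n) * det (mat n n (\<lambda>(i, j). cmono {#(int i - \<beta>, int j + \<alpha>)#}))) M"
    unfolding coefficient_of_int_mult det sum .
qed

text \<open>Place 1 is empty in T^(-1) v0, whereas the generators empty even places only.\<close>

lemma tau_minus_one: "tau (- 1) \<alpha> \<beta> = 0"
proof (rule cseries_eqI)
  fix M
  let ?N = "shift_pairs \<beta> (- \<alpha>) M"
  have p: "pos 1 (- (- 1) - 1) = 1" "pos 0 (- 1) = - 2" by (simp_all add: pos_def)
  have "psi_minus 1 (- 1) (Q0 v0) = - Q0 (psi_minus 1 (- 1) v0)"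
    using Q_basics(10) unfolding anticommutes_field_def by blast
  then have "Tpow (- 1) v0 = fscale (- 1) (psi_minus 1 (- 1) (psi_plus 0 (- 1) v0))"
    using Q_basics(5,8) by (simp add: Tpow_def int_iter_def fock.scale_minus_left)
  then have T: "Tpow (- 1) v0 = fscale (- 1) (contract 1 (wedge (- 2) v0))"
    unfolding psi_plus_def psi_minus_def p .
  have "signed_ket (wedge (- 2) v0) (insert (- 2) {0..})"
    by (rule signed_ket_wedge[OF signed_ket_v0]) simp
  then have sk: "signed_ket (contract 1 (wedge (- 2) v0)) (insert (- 2) {0..} - {1})"
    by (rule signed_ket_contract) simp
  have "form (contract 1 (wedge (- 2) v0)) (excited ?N) = 0"
  proof (cases "rook_placement ?N")
    case True
    have "1 \<in> excited_occ ?N" using excited_occ_odd[of "- 1" ?N] by simp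
    then have "insert (- 2) {0..} - {1} \<noteq> excited_occ ?N" by blast
    with True show ?thesis using excited_cases[of ?N] form_signed_ket_neq[OF sk] by simp
  next
    case False
    then show ?thesis using excited_cases[of ?N] by simp
  qed
  then have "form (Tpow (- 1) v0) (excited ?N) = 0"
    using form_fscale[of "- 1" _ 1 "excited ?N"] unfolding T by simp
  then show "coefficient (tau (- 1) \<alpha> \<beta>) M = coefficient 0 M"
    by (simp add: coefficient_tau zero_cseries.rep_eq)
qed

theorem mainTheorem3:
  fixes k \<alpha> \<beta> :: int
  assumes "0 \<le> k"
  shows "tau k (\<alpha> + 1) \<beta> * tau k \<alpha> (\<beta> + 1) + tau (k + 1) \<alpha> (\<beta> + 1) * tau (k - 1) (\<alpha> + 1) \<beta>
       = tau k \<alpha> \<beta> * tau k (\<alpha> + 1) (\<beta> + 1)"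
proof (cases "k = 0")
  case True
  have "tau 0 \<alpha> \<beta> = 1" for \<alpha> \<beta>
    using tau_eq_det[of 0 \<alpha> \<beta>] by (simp add: triangular_sign_def)
  with True show ?thesis by (simp add: tau_minus_one)
next
  case False
  \<comment> \<open>This makes all three sizes k - 1, k and k + 1 natural numbers.\<close>
  with assms obtain m where k: "k = int (m + 1)"
    by (metis add.commute int_one_le_iff_zero_less le_less of_nat_1 of_nat_add zle_iff_zadd)
  \<comment> \<open>The array starts at the parameters (\<alpha>, \<beta> + 1): lowering \<beta> + 1
    to \<beta> moves the rows by one, and raising \<alpha> moves the columns by one.\<close>
  define f where "f i j = cmono {#(int i - (\<beta> + 1), int j + \<alpha>)#}" for i j
  define s where "s = psign (\<alpha> + \<beta>)"
  have s: "psign (\<alpha> + 1 + \<beta>) = - s" "psign (\<alpha> + (\<beta> + 1)) = - s"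
    "psign (\<alpha> + 1 + (\<beta> + 1)) = s" "psign (\<alpha> + \<beta>) = s"
    by (simp_all add: s_def psign_def)
  have tau: "tau (int n) \<alpha> (\<beta> + 1) = of_int (triangular_sign n * (- s) ^ n) * consecutive_minor f n 0 0"
    "tau (int n) (\<alpha> + 1) \<beta> = of_int (triangular_sign n * (- s) ^ n) * consecutive_minor f n 1 1"
    "tau (int n) \<alpha> \<beta> = of_int (triangular_sign n * s ^ n) * consecutive_minor f n 1 0"
    "tau (int n) (\<alpha> + 1) (\<beta> + 1) = of_int (triangular_sign n * s ^ n) * consecutive_minor f n 0 1"
    for n
    unfolding tau_eq_det s consecutive_minor_def f_def by (simp_all add: algebra_simps)
  \<comment> \<open>Factors of equal size have equal signs, which square to 1; sizes m and m + 2
    leave the -1 of \<open>triangular_sign_add_2\<close>.\<close>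
  have signs: "triangular_sign (m + 1) * (- s) ^ (m + 1) * (triangular_sign (m + 1) * (- s) ^ (m + 1)) = 1"
    "triangular_sign (m + 1) * s ^ (m + 1) * (triangular_sign (m + 1) * s ^ (m + 1)) = 1"
    "triangular_sign (m + 2) * (- s) ^ (m + 2) * (triangular_sign m * (- s) ^ m) = - 1"
  proof -
    have sq: "s * s = 1" by (simp add: s_def)
    have "x * y * (x * y) = x * x * (y * y)" for x y :: int by simp
    then show "triangular_sign (m + 1) * (- s) ^ (m + 1) * (triangular_sign (m + 1) * (- s) ^ (m + 1)) = 1"
      "triangular_sign (m + 1) * s ^ (m + 1) * (triangular_sign (m + 1) * s ^ (m + 1)) = 1"
      by (simp_all only: triangular_sign_square flip: power_mult_distrib) (simp_all add: sq)
    have "triangular_sign (m + 2) * (- s) ^ (m + 2) * (triangular_sign m * (- s) ^ m)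
        = triangular_sign (m + 2) * triangular_sign m * (s * s) * ((- s) ^ m * (- s) ^ m)"
      by (simp add: power_add power2_eq_square)
    then show "triangular_sign (m + 2) * (- s) ^ (m + 2) * (triangular_sign m * (- s) ^ m) = - 1"
      by (simp only: triangular_sign_add_2 sq flip: power_mult_distrib) (simp add: sq)
  qed
  have regroup: "of_int a * x * (of_int b * y) = of_int (a * b) * (x * y)" for a b and x y :: cseries
    by (simp add: mult_ac)
  have "k + 1 = int (m + 2)" "k - 1 = int m" using k by simp_all
  then show ?thesis
    unfolding k(1) by (simp only: tau regroup signs) (use desnanot_jacobi[of f m] in \<open>simp add: algebra_simps\<close>)
qed

end
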